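(* Let $\Phi=(f_i)_{i=1}^N\in\mathfrak{S}_N$. If for all distinct $\mathbf{i},\mathbf{j}\in\Sigma\cup\Sigma_*$ with $|\mathbf{i}|=|\mathbf{j}|$ we have $$\sup_{x\in[0,1]}|H_{\mathbf{i}}(x)-H_{\mathbf{j}}(x)|>0,$$ then $\Phi$ satisfies the SESC.
   Context: Fix $\epsilon>0$, write $I=[0,1]$ and, for $\delta>0$, $\mathcal{B}_\delta=\{z\in\mathbb{C}: \exists x\in I,\ |z-x|<\delta\}$. $\mathcal{S}^\omega_\epsilon(I)$ is the class of maps $f:\mathbb{R}\to\mathbb{R}$ such that: (A) $f$ is (extends to be) complex analytic on $\mathcal{B}_{2\epsilon}$; (B) $f(I)\subseteq I$ and $f(\overline{\mathcal{B}_\epsilon})\subseteq\mathcal{B}_\epsilon$; (C) $0<|f'(x)|<1$ for all $x\in\overline{\mathcal{B}_\epsilon}$. $\mathfrak{S}_N$ is the set of ordered $N$-tuples (IFSs) $\Phi=(f_i)_{i=1}^N$ with $f_i\in\mathcal{S}^\omega_\epsilon(I)$. Let $\mathcal{I}=\{1,\dots,N\}$, $\Sigma_n=\mathcal{I}^n$, $\Sigma_*=\bigcup_{n\ge0}\Sigma_n$ (with $\Sigma_0=\{\emptyset\}$), $\Sigma=\mathcal{I}^{\mathbb{N}}$; $|\mathbf{i}|$ is the length of a word ($|\mathbf{i}|=\infty$ for $\mathbf{i}\in\Sigma$). For a finite word, $f_{i_1,\dots,i_n}=f_{i_1}\circ\cdots\circ f_{i_n}$, $f_\emptyset=\mathrm{Id}$;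 and $\mathbf{i}_{n}^1=(i_n,i_{n-1},\dots,i_1)$, so $f_{\mathbf{i}_n^1}=f_{i_n}\circ\cdots\circ f_{i_1}$, with $\mathbf{i}_0^1=\emptyset$. For $\mathbf{i}\in\Sigma\cup\Sigma_*$, $$H_{\mathbf{i}}(x)=\sum_{n=1}^{|\mathbf{i}|}\frac{f''_{i_n}}{f'_{i_n}}\big(f_{\mathbf{i}_{n-1}^1}(x)\big)\cdot f'_{\mathbf{i}_{n-1}^1}(x).$$ $\Phi$ satisfies the strong exponential separation condition (SESC) if there exists $c>0$ such that $\sup_{x\in[0,1]}|f_{\mathbf{i}}(x)-f_{\mathbf{j}}(x)|\ge c^n$ for all $n\in\mathbb{N}$ and all $\mathbf{i}\ne\mathbf{j}$ in $\Sigma_n$. *)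

theory Defs
  imports "HOL-Complex_Analysis.Complex_Analysis" "HOL-Library.Extended_Nat"
begin

definition nbhd_I :: "real \<Rightarrow> complex set" where
  "nbhd_I \<delta> = {z. \<exists>x\<in>{0..1}. norm (z - complex_of_real x) < \<delta>}"

text \<open>
  The witness \<open>F\<close> is the complex analytic extension of \<open>f\<close>; it is unique on the connected open
  set \<open>nbhd_I (2 * \<epsilon>)\<close>, so the conditions on complex points do not depend on its choice.
\<close>
definition analytic_maps :: "real \<Rightarrow> (real \<Rightarrow> real) set" where
  "analytic_maps \<epsilon> = {f. \<exists>F :: complex \<Rightarrow> complex.
      F analytic_on nbhd_I (2 * \<epsilon>) \<and>
      (\<forall>x. complex_of_real x \<in> nbhd_I (2 * \<epsilon>) \<longrightarrow> F (complex_of_real x) = complex_of_real (f x)) \<and>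
      f ` {0..1} \<subseteq> {0..1} \<and>
      F ` closure (nbhd_I \<epsilon>) \<subseteq> nbhd_I \<epsilon> \<and>
      (\<forall>z\<in>closure (nbhd_I \<epsilon>). 0 < norm (deriv F z) \<and> norm (deriv F z) < 1)}"

text \<open>An \<open>N\<close>-tuple is a function on \<open>nat\<close> of which only the values at \<open>1, \<dots>, N\<close> are used.\<close>
definition IFSs :: "real \<Rightarrow> nat \<Rightarrow> (nat \<Rightarrow> real \<Rightarrow> real) set" where
  "IFSs \<epsilon> N = {\<Phi>. \<forall>i\<in>{1..N}. \<Phi> i \<in> analytic_maps \<epsilon>}"

definition words_of_length :: "nat \<Rightarrow> nat \<Rightarrow> nat list set" where
  "words_of_length N n = {w. set w \<subseteq> {1..N} \<and> length w = n}"

primrec word_map :: "(nat \<Rightarrow> real \<Rightarrow> real) \<Rightarrow> nat list \<Rightarrow> real \<Rightarrow> real" where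
  "word_map \<Phi> [] = id"
| "word_map \<Phi> (i # w) = \<Phi> i \<circ> word_map \<Phi> w"

text \<open>
  Elements of \<open>\<Sigma> \<union> \<Sigma>\<^sub>*\<close>. Positions are counted from \<open>0\<close>, so the letter \<open>i\<^sub>n\<close> is at position
  \<open>n - 1\<close>.
\<close>
datatype code = Fin_code "nat list" | Inf_code "nat \<Rightarrow> nat"

primrec code_length :: "code \<Rightarrow> enat" where
  "code_length (Fin_code w) = enat (length w)"
| "code_length (Inf_code s) = \<infinity>"

primrec code_letters :: "code \<Rightarrow> nat set" where
  "code_letters (Fin_code w) = set w"
| "code_letters (Inf_code s) = range s"

definition codes :: "nat \<Rightarrow> code set" where
  "codes N = {\<omega>. code_letters \<omega> \<subseteq> {1..N}}"

text \<open>
  \<open>H_term \<Phi> i u x\<close> is the summand of \<open>H\<close> belonging to the letter \<open>i\<close> preceded by the word \<open>u\<close>;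
  the reversal turns \<open>u = (i\<^sub>1, \<dots>, i\<^sub>k)\<close> into \<open>(i\<^sub>k, \<dots>, i\<^sub>1)\<close>.
\<close>
definition H_term :: "(nat \<Rightarrow> real \<Rightarrow> real) \<Rightarrow> nat \<Rightarrow> nat list \<Rightarrow> real \<Rightarrow> real" where
  "H_term \<Phi> i u x =
     deriv (deriv (\<Phi> i)) (word_map \<Phi> (rev u) x) / deriv (\<Phi> i) (word_map \<Phi> (rev u) x)
       * deriv (word_map \<Phi> (rev u)) x"

primrec H :: "(nat \<Rightarrow> real \<Rightarrow> real) \<Rightarrow> code \<Rightarrow> real \<Rightarrow> real" where
  "H \<Phi> (Fin_code w) = (\<lambda>x. \<Sum>k<length w. H_term \<Phi> (w ! k) (take k w) x)"
| "H \<Phi> (Inf_code s) = (\<lambda>x. \<Sum>k. H_term \<Phi> (s k) (map s [0..<k]) x)"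

definition SESC :: "nat \<Rightarrow> (nat \<Rightarrow> real \<Rightarrow> real) \<Rightarrow> bool" where
  "SESC N \<Phi> \<longleftrightarrow> (\<exists>c>0. \<forall>n. \<forall>v\<in>words_of_length N n. \<forall>w\<in>words_of_length N n. v \<noteq> w \<longrightarrow>
      (SUP x\<in>{0..1}. \<bar>word_map \<Phi> v x - word_map \<Phi> w x\<bar>) \<ge> c ^ n)"

end

theory Submission
  imports Defs
begin

text \<open>
  For a finite word \<open>i\<close> with \<open>f = f\<^bsub>rev i\<^esub>\<close> one has \<open>H\<^sub>i = f'' / f'\<close>, the logarithmic derivative of \<open>f'\<close>.
  Consider pairs of codes of equal length with different first letters. They form a compact
  space, on which \<open>H\<^sub>i - H\<^sub>j\<close> depends continuously and, by hypothesis, is never identically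
  zero; as these functions are analytic, some derivative of order at most \<open>K\<close> is bounded below
  near every point, with \<open>K\<close> and the bounds uniform over all pairs. A function whose derivative
  is large on an interval is itself large on a fixed fraction of it. Starting from an interval of
  length \<open>\<l>\<close>, descend in this way from the \<open>k\<close>-th derivative of \<open>H\<^sub>i - H\<^sub>j\<close> to \<open>H\<^sub>i - H\<^sub>j\<close>, then to
  \<open>f' / g' - 1\<close> with \<open>f = f\<^bsub>rev i\<^esub>\<close>, \<open>g = f\<^bsub>rev j\<^esub>\<close>, since \<open>(f' / g')' = (f' / g') (H\<^sub>i - H\<^sub>j)\<close>, and then to
  \<open>f - g\<close>; only a constant times a power of \<open>\<l>\<close> and of \<open>min |f'|\<close>
  is lost. Two words of length \<open>n\<close> that share a suffix \<open>u\<close> are compared on the interval \<open>f\<^sub>u(I)\<close>,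
  whose length is at least exponentially small in \<open>n\<close>.
\<close>

section \<open>Lower bounds from derivatives\<close>

text \<open>By the mean value theorem \<open>g\<close> changes at rate at least \<open>a\<close>, so
  all points at least a quarter of the interval away from a point with a small value have large
  values. The end quarter beyond the midpoint, seen from such a point, therefore works.\<close>

lemma large_on_subinterval:
  fixes g g' :: "real \<Rightarrow> real"
  assumes "\<alpha> < \<beta>" and "0 < a"
    and g: "\<And>x. x \<in> {\<alpha>..\<beta>} \<Longrightarrow> (g has_real_derivative g' x) (at x)"
    and a: "\<And>x. x \<in> {\<alpha>..\<beta>} \<Longrightarrow> a \<le> \<bar>g' x\<bar>"
  obtains \<alpha>' \<beta>' where "\<alpha> \<le> \<alpha>'" "\<beta>' \<le> \<beta>" "\<beta>' - \<alpha>' = (\<beta> - \<alpha>) / 4"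
    and "\<And>x. x \<in> {\<alpha>'..\<beta>'} \<Longrightarrow> a * ((\<beta> - \<alpha>) / 8) \<le> \<bar>g x\<bar>"
proof -
  have lip: "a * (y - x) \<le> \<bar>g y - g x\<bar>" if "x \<in> {\<alpha>..\<beta>}" "y \<in> {\<alpha>..\<beta>}" "x < y" for x y
  proof -
    have "\<And>t. x \<le> t \<Longrightarrow> t \<le> y \<Longrightarrow> (g has_real_derivative g' t) (at t)"
      using that g by auto
    from MVT2[OF \<open>x < y\<close> this] obtain z where z: "x < z" "z < y" "g y - g x = (y - x) * g' z"
      by blast
    have "a \<le> \<bar>g' z\<bar>" using a z that by auto
    then show ?thesis
      using z that by (simp add: abs_mult mult.commute mult_left_mono)
  qed
  show ?thesis
  proof (cases "\<exists>x\<^sub>0\<in>{\<alpha>..\<beta>}. \<bar>g x\<^sub>0\<bar> < a * ((\<beta> - \<alpha>) / 8)")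
    case False
    show ?thesis
    proof (rule that[of \<alpha> "\<alpha> + (\<beta> - \<alpha>) / 4"])
      show "a * ((\<beta> - \<alpha>) / 8) \<le> \<bar>g x\<bar>" if "x \<in> {\<alpha>..\<alpha> + (\<beta> - \<alpha>) / 4}" for x
        proof -
        have "x \<in> {\<alpha>..\<beta>}" using that assms(1) by (auto simp: field_simps)
        then show ?thesis using False by (meson not_less)
      qed
    qed (use assms(1) in \<open>auto simp: field_simps\<close>)
  next
    case True
    then obtain x\<^sub>0 where x\<^sub>0: "x\<^sub>0 \<in> {\<alpha>..\<beta>}" "\<bar>g x\<^sub>0\<bar> < a * ((\<beta> - \<alpha>) / 8)" by blast
    have far: "a * ((\<beta> - \<alpha>) / 8) \<le> \<bar>g x\<bar>"
      if "x \<in> {\<alpha>..\<beta>}" "(\<beta> - \<alpha>) / 4 \<le> \<bar>x - x\<^sub>0\<bar>" for x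
    proof -
      have "a * \<bar>x - x\<^sub>0\<bar> \<le> \<bar>g x - g x\<^sub>0\<bar>"
        using lip[of x x\<^sub>0] lip[of x\<^sub>0 x] that x\<^sub>0 by (cases x x\<^sub>0 rule: linorder_cases) auto
      moreover have "a * ((\<beta> - \<alpha>) / 4) \<le> a * \<bar>x - x\<^sub>0\<bar>"
        using that assms(2) by (intro mult_left_mono) auto
      ultimately show ?thesis using x\<^sub>0 by argo
    qed
    show ?thesis
    proof (cases "x\<^sub>0 \<le> (\<alpha> + \<beta>) / 2")
      case True
      show ?thesis
      proof (rule that[of "\<beta> - (\<beta> - \<alpha>) / 4" \<beta>])
        show "a * ((\<beta> - \<alpha>) / 8) \<le> \<bar>g x\<bar>" if "x \<in> {\<beta> - (\<beta> - \<alpha>) / 4..\<beta>}" for x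
          by (rule far) (use that True assms(1) in \<open>auto simp: field_simps\<close>)
      qed (use assms(1) in \<open>auto simp: field_simps\<close>)
    next
      case False
      show ?thesis
      proof (rule that[of \<alpha> "\<alpha> + (\<beta> - \<alpha>) / 4"])
        show "a * ((\<beta> - \<alpha>) / 8) \<le> \<bar>g x\<bar>" if "x \<in> {\<alpha>..\<alpha> + (\<beta> - \<alpha>) / 4}" for x
          by (rule far) (use that False assms(1) in \<open>auto simp: field_simps\<close>)
      qed (use assms(1) in \<open>auto simp: field_simps\<close>)
    qed
  qed
qed

text \<open>Each descent by one derivative keeps a quarter of the interval and multiplies the bound
  by one eighth of its current length; the stated bound is a cruder closed form of the resulting
  product.\<close>

lemma large_on_subinterval_iterated:
  fixes D :: "nat \<Rightarrow> real \<Rightarrow> real"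
  assumes "\<alpha> < \<beta>" and "0 < a"
    and "\<And>j x. x \<in> {\<alpha>..\<beta>} \<Longrightarrow> (D j has_real_derivative D (Suc j) x) (at x)"
    and "\<And>x. x \<in> {\<alpha>..\<beta>} \<Longrightarrow> a \<le> \<bar>D k x\<bar>"
  shows "\<exists>\<alpha>' \<beta>'. \<alpha> \<le> \<alpha>' \<and> \<beta>' \<le> \<beta> \<and> \<beta>' - \<alpha>' = (\<beta> - \<alpha>) / 4 ^ k \<and>
    (\<forall>x\<in>{\<alpha>'..\<beta>'}. a * ((\<beta> - \<alpha>) / 8 ^ Suc k) ^ k \<le> \<bar>D 0 x\<bar>)"
  using assms
proof (induction k arbitrary: \<alpha> \<beta> a)
  case 0
  show ?case using 0 by (intro exI[of _ \<alpha>] exI[of _ \<beta>]) auto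
next
  case (Suc k)
  obtain \<alpha>1 \<beta>1 where 1: "\<alpha> \<le> \<alpha>1" "\<beta>1 \<le> \<beta>" "\<beta>1 - \<alpha>1 = (\<beta> - \<alpha>) / 4"
      "\<And>x. x \<in> {\<alpha>1..\<beta>1} \<Longrightarrow> a * ((\<beta> - \<alpha>) / 8) \<le> \<bar>D k x\<bar>"
    using large_on_subinterval[of \<alpha> \<beta> a "D k" "D (Suc k)"] Suc.prems by metis
  have "\<alpha>1 < \<beta>1" using 1 Suc.prems(1) by auto
  have "\<exists>\<alpha>' \<beta>'. \<alpha>1 \<le> \<alpha>' \<and> \<beta>' \<le> \<beta>1 \<and> \<beta>' - \<alpha>' = (\<beta>1 - \<alpha>1) / 4 ^ k \<and>
    (\<forall>x\<in>{\<alpha>'..\<beta>'}. a * ((\<beta> - \<alpha>) / 8) * ((\<beta>1 - \<alpha>1) / 8 ^ Suc k) ^ k \<le> \<bar>D 0 x\<bar>)"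
    using 1 Suc.prems \<open>\<alpha>1 < \<beta>1\<close> by (intro Suc.IH) auto
  then obtain \<alpha>' \<beta>' where 2: "\<alpha>1 \<le> \<alpha>'" "\<beta>' \<le> \<beta>1" "\<beta>' - \<alpha>' = (\<beta>1 - \<alpha>1) / 4 ^ k"
    "\<And>x. x\<in>{\<alpha>'..\<beta>'} \<Longrightarrow> a * ((\<beta> - \<alpha>) / 8) * ((\<beta>1 - \<alpha>1) / 8 ^ Suc k) ^ k \<le> \<bar>D 0 x\<bar>"
    by blast
  \<comment> \<open>One of the \<open>Suc k\<close> equal factors pays for the first descent, the
    other \<open>k\<close> for the induction hypothesis on an interval of length
    \<open>(\<beta> - \<alpha>) / 4\<close>.\<close>
  have "((\<beta> - \<alpha>) / 8 ^ Suc (Suc k)) ^ Suc k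
      = ((\<beta> - \<alpha>) / 8 ^ Suc (Suc k)) * ((\<beta> - \<alpha>) / 8 ^ Suc (Suc k)) ^ k" by simp
  also have "\<dots> \<le> ((\<beta> - \<alpha>) / 8) * ((\<beta>1 - \<alpha>1) / 8 ^ Suc k) ^ k"
  proof (intro mult_mono power_mono)
    show "(\<beta> - \<alpha>) / 8 ^ Suc (Suc k) \<le> (\<beta> - \<alpha>) / 8"
      using Suc.prems(1) self_le_power[of "8::real" "Suc (Suc k)"]
      by (intro divide_left_mono) auto
    show "(\<beta> - \<alpha>) / 8 ^ Suc (Suc k) \<le> (\<beta>1 - \<alpha>1) / 8 ^ Suc k"
      unfolding 1 using Suc.prems(1) by (simp add: field_simps)
  qed (use Suc.prems(1) in auto)
  finally have "a * ((\<beta> - \<alpha>) / 8 ^ Suc (Suc k)) ^ Suc k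
      \<le> a * ((\<beta> - \<alpha>) / 8) * ((\<beta>1 - \<alpha>1) / 8 ^ Suc k) ^ k"
    using Suc.prems(2) by (simp only: mult.assoc mult_left_mono less_imp_le)
  then have "\<forall>x\<in>{\<alpha>'..\<beta>'}. a * ((\<beta> - \<alpha>) / 8 ^ Suc (Suc k)) ^ Suc k \<le> \<bar>D 0 x\<bar>"
    using 2(4) order_trans by blast
  moreover have "\<alpha> \<le> \<alpha>'" "\<beta>' \<le> \<beta>" "\<beta>' - \<alpha>' = (\<beta> - \<alpha>) / 4 ^ Suc k"
    using 1(1,2) 2(1,2) by (auto simp: 2(3) 1(3))
  ultimately show ?case by blast
qed

section \<open>Holomorphic functions on the real line\<close>

lemma field_derivative_along_reals:
  fixes F :: "complex \<Rightarrow> complex"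
  assumes "(F has_field_derivative D) (at (complex_of_real x))"
  shows "((\<lambda>t. Re (F (complex_of_real t))) has_real_derivative Re D) (at x)"
    and "((\<lambda>t. Im (F (complex_of_real t))) has_real_derivative Im D) (at x)"
proof -
  have "((\<lambda>t. F (complex_of_real t)) has_vector_derivative D) (at x)"
    using has_vector_derivative_real_field[OF assms] by simp
  from bounded_linear.has_vector_derivative[OF bounded_linear_Re this]
    bounded_linear.has_vector_derivative[OF bounded_linear_Im this]
  show "((\<lambda>t. Re (F (complex_of_real t))) has_real_derivative Re D) (at x)"
    and "((\<lambda>t. Im (F (complex_of_real t))) has_real_derivative Im D) (at x)"
    by (simp_all add: has_real_derivative_iff_has_vector_derivative)
qed

lemma open_real_trace: "open S \<Longrightarrow> open {t. complex_of_real t \<in> S}"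
  using open_vimage[of S complex_of_real] by (simp add: vimage_def)

text \<open>The imaginary part of \<open>f\<close> vanishes on the open trace of \<open>S\<close> on
  the real line, hence so does its derivative along that line, which is the imaginary part of
  \<open>deriv f\<close>.\<close>

lemma deriv_in_Reals:
  assumes "f holomorphic_on S" "open S"
    and real: "\<And>x. complex_of_real x \<in> S \<Longrightarrow> f (complex_of_real x) \<in> \<real>"
    and x: "complex_of_real x \<in> S"
  shows "deriv f (complex_of_real x) \<in> \<real>"
proof -
  have "((\<lambda>t. Im (f (complex_of_real t))) has_real_derivative Im (deriv f (complex_of_real x))) (at x)"
    using assms by (intro field_derivative_along_reals holomorphic_derivI)
  moreover have "((\<lambda>t. Im (f (complex_of_real t))) has_real_derivative 0) (at x)"
    by (rule has_field_derivative_transform_within_open[where f = "\<lambda>_. 0" and S = "{t. complex_of_real t \<in> S}"])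
      (use x real assms(2) in \<open>auto simp: open_real_trace complex_is_Real_iff\<close>)
  ultimately show ?thesis
    using DERIV_unique by (auto simp: complex_is_Real_iff)
qed

lemma higher_deriv_in_Reals:
  assumes "f holomorphic_on S" "open S"
    and "\<And>x. complex_of_real x \<in> S \<Longrightarrow> f (complex_of_real x) \<in> \<real>"
    and "complex_of_real x \<in> S"
  shows "(deriv ^^ k) f (complex_of_real x) \<in> \<real>"
  using assms(4)
proof (induction k arbitrary: x)
  case (Suc k)
  then show ?case
    using deriv_in_Reals[of "(deriv ^^ k) f" S x] assms(1,2) by (simp add: holomorphic_higher_deriv)
qed (use assms in auto)

section \<open>The functions \<open>H\<close> of padded sequences\<close>

text \<open>The type is left open so that the same formulas serve the real maps and their complex
  extensions. The first letter is applied first.\<close>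

primrec orbit :: "(nat \<Rightarrow> 'a \<Rightarrow> 'a) \<Rightarrow> (nat \<Rightarrow> nat) \<Rightarrow> nat \<Rightarrow> 'a \<Rightarrow> 'a" where
  "orbit F s 0 z = z"
| "orbit F s (Suc k) z = F (s k) (orbit F s k z)"

text \<open>The chain rule product for the derivative of \<open>orbit F s k\<close>, which can be
  estimated factor by factor.\<close>

definition orbit_deriv :: "(nat \<Rightarrow> 'a \<Rightarrow> 'a::real_normed_field) \<Rightarrow> (nat \<Rightarrow> nat) \<Rightarrow> nat \<Rightarrow> 'a \<Rightarrow> 'a" where
  "orbit_deriv F s k z = (\<Prod>j<k. deriv (F (s j)) (orbit F s j z))"

text \<open>The summand of \<open>H\<close> for the letter \<open>s k\<close>, with the derivative
  of the inner composition written as the chain rule product.\<close>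

definition nonlin_term :: "(nat \<Rightarrow> 'a \<Rightarrow> 'a::real_normed_field) \<Rightarrow> (nat \<Rightarrow> nat) \<Rightarrow> nat \<Rightarrow> 'a \<Rightarrow> 'a" where
  "nonlin_term F s k z =
     deriv (deriv (F (s k))) (orbit F s k z) / deriv (F (s k)) (orbit F s k z) * orbit_deriv F s k z"

text \<open>\<open>H\<close> of an infinite sequence. When \<open>F 0\<close> is the zero map, the
  series of a word continued by the letter \<open>0\<close> breaks off, so words and sequences share
  one definition.\<close>

definition nonlin :: "(nat \<Rightarrow> 'a \<Rightarrow> 'a::real_normed_field) \<Rightarrow> (nat \<Rightarrow> nat) \<Rightarrow> 'a \<Rightarrow> 'a" where
  "nonlin F s z = (\<Sum>k. nonlin_term F s k z)"

lemma orbit_cong: "(\<And>j. j < k \<Longrightarrow> s j = t j) \<Longrightarrow> orbit F s k = orbit F t k"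
  by (induction k) auto

lemma nonlin_term_cong:
  assumes "\<And>j. j \<le> k \<Longrightarrow> s j = t j"
  shows "nonlin_term F s k z = nonlin_term F t k z"
proof -
  have "orbit F s j = orbit F t j" if "j \<le> k" for j
    using assms that by (intro orbit_cong) auto
  then show ?thesis
    using assms by (auto simp: nonlin_term_def orbit_deriv_def intro!: prod.cong)
qed

text \<open>Letter \<open>0\<close> of a sequence marks positions behind the end of a finite word.\<close>
definition separated_pair :: "nat \<Rightarrow> (nat \<Rightarrow> nat) \<Rightarrow> (nat \<Rightarrow> nat) \<Rightarrow> bool" where
  "separated_pair N s t \<longleftrightarrow> s 0 \<noteq> t 0 \<and> (\<forall>k. s k \<le> N \<and> t k \<le> N \<and> (s k = 0 \<longleftrightarrow> t k = 0) \<and>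
     (s k = 0 \<longrightarrow> s (Suc k) = 0))"

text \<open>Uniform bounds on a common invariant domain, for all letters including the padding
  letter \<open>0\<close>. As the derivative of a constant padding map vanishes, f''/f' is assumed
  holomorphic and bounded as a whole, without a lower bound on f'.\<close>

locale holomorphic_ifs =
  fixes S :: "complex set" and N :: nat and F :: "nat \<Rightarrow> complex \<Rightarrow> complex" and \<rho> M :: real
  assumes open_S: "open S" and connected_S: "connected S"
    and \<rho>: "0 \<le> \<rho>" "\<rho> < 1" and M: "0 \<le> M"
    and F_hol: "\<And>i. i \<le> N \<Longrightarrow> F i holomorphic_on S"
    and F_in: "\<And>i z. i \<le> N \<Longrightarrow> z \<in> S \<Longrightarrow> F i z \<in> S"
    and F_real: "\<And>i x. i \<le> N \<Longrightarrow> complex_of_real x \<in> S \<Longrightarrow> F i (complex_of_real x) \<in> \<real>"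
    and deriv_le: "\<And>i z. i \<le> N \<Longrightarrow> z \<in> S \<Longrightarrow> norm (deriv (F i) z) \<le> \<rho>"
    and quot_hol: "\<And>i. i \<le> N \<Longrightarrow> (\<lambda>z. deriv (deriv (F i)) z / deriv (F i) z) holomorphic_on S"
    and quot_le: "\<And>i z. i \<le> N \<Longrightarrow> z \<in> S \<Longrightarrow> norm (deriv (deriv (F i)) z / deriv (F i) z) \<le> M"
begin

section \<open>Convergence, holomorphy and reality of the series for one sequence\<close>

context
  fixes s :: "nat \<Rightarrow> nat"
  assumes s: "\<And>k. s k \<le> N"
begin

lemma orbit_in: "z \<in> S \<Longrightarrow> orbit F s k z \<in> S"
  by (induction k) (auto intro: F_in s)

lemma orbit_hol: "orbit F s k holomorphic_on S"
proof (induction k)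
  case (Suc k)
  have "(F (s k) \<circ> orbit F s k) holomorphic_on S"
    using Suc F_hol[OF s] by (rule holomorphic_on_compose_gen) (auto intro: orbit_in)
  then show ?case by (simp add: o_def)
qed (simp add: holomorphic_on_ident)

lemma orbit_deriv_hol: "orbit_deriv F s k holomorphic_on S"
proof -
  have "(deriv (F (s j)) \<circ> orbit F s j) holomorphic_on S" for j
    using orbit_hol holomorphic_deriv[OF F_hol[OF s] open_S]
    by (rule holomorphic_on_compose_gen) (auto intro: orbit_in)
  then show ?thesis
    unfolding orbit_deriv_def[abs_def] o_def by (intro holomorphic_on_prod)
qed

lemma orbit_deriv_le: "z \<in> S \<Longrightarrow> norm (orbit_deriv F s k z) \<le> \<rho> ^ k"
  unfolding orbit_deriv_def prod_norm[symmetric]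
  using prod_mono[of "{..<k}" "\<lambda>j. norm (deriv (F (s j)) (orbit F s j z))" "\<lambda>_. \<rho>"]
  by (simp add: deriv_le s orbit_in)

lemma nonlin_term_hol: "nonlin_term F s k holomorphic_on S"
proof -
  have "((\<lambda>z. deriv (deriv (F (s k))) z / deriv (F (s k)) z) \<circ> orbit F s k) holomorphic_on S"
    using orbit_hol quot_hol[OF s] by (rule holomorphic_on_compose_gen) (auto intro: orbit_in)
  then show ?thesis
    unfolding nonlin_term_def[abs_def] o_def by (intro holomorphic_on_mult orbit_deriv_hol)
qed

lemma nonlin_term_le: "z \<in> S \<Longrightarrow> norm (nonlin_term F s k z) \<le> M * \<rho> ^ k"
  unfolding nonlin_term_def norm_mult
  by (intro mult_mono quot_le s orbit_in orbit_deriv_le M) auto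

lemma summable_nonlin_term: "z \<in> S \<Longrightarrow> summable (\<lambda>k. nonlin_term F s k z)"
  using \<rho> by (intro summable_comparison_test'[OF summable_mult[OF summable_geometric[of \<rho>], of M]])
    (auto intro: nonlin_term_le)

text \<open>The majorant \<open>M * \<rho> ^ k\<close> makes the series converge uniformly on all of
  \<open>S\<close>, and uniform limits of holomorphic functions are holomorphic.\<close>

lemma nonlin_hol: "nonlin F s holomorphic_on S"
proof (rule holomorphic_uniform_sequence[OF open_S])
  show "(\<lambda>z. \<Sum>k<n. nonlin_term F s k z) holomorphic_on S" for n
    by (intro holomorphic_on_sum nonlin_term_hol)
  fix x assume "x \<in> S"
  then obtain d where d: "d > 0" "cball x d \<subseteq> S"
    using open_S open_contains_cball by blast
  have "uniform_limit S (\<lambda>n z. \<Sum>k<n. nonlin_term F s k z) (nonlin F s) sequentially"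
    unfolding nonlin_def[abs_def]
    by (rule Weierstrass_m_test[where M = "\<lambda>k. M * \<rho> ^ k"])
      (use \<rho> in \<open>auto intro: nonlin_term_le summable_mult summable_geometric\<close>)
  then show "\<exists>d>0. cball x d \<subseteq> S \<and>
      uniform_limit (cball x d) (\<lambda>n z. \<Sum>k<n. nonlin_term F s k z) (nonlin F s) sequentially"
    using d uniform_limit_on_subset by blast
qed

lemma nonlin_tail:
  assumes "z \<in> S"
  shows "norm (nonlin F s z - (\<Sum>j<k. nonlin_term F s j z)) \<le> M * \<rho> ^ k / (1 - \<rho>)"
proof -
  have "nonlin F s z - (\<Sum>j<k. nonlin_term F s j z) = (\<Sum>j. nonlin_term F s (j + k) z)"
    unfolding nonlin_def using suminf_minus_initial_segment[OF summable_nonlin_term[OF assms]] by metis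
  moreover have "norm (\<Sum>j. nonlin_term F s (j + k) z) \<le> (\<Sum>j. M * \<rho> ^ k * \<rho> ^ j)"
    using \<rho> nonlin_term_le[OF assms, of "_ + k"]
    by (intro norm_suminf_le summable_mult summable_geometric) (simp_all add: power_add mult_ac)
  moreover have "(\<Sum>j. M * \<rho> ^ k * \<rho> ^ j) = M * \<rho> ^ k / (1 - \<rho>)"
    using \<rho> by (subst suminf_mult) (auto simp: suminf_geometric summable_geometric)
  ultimately show ?thesis by simp
qed

lemma orbit_real: "complex_of_real x \<in> S \<Longrightarrow> orbit F s k (complex_of_real x) \<in> \<real>"
proof (induction k)
  case (Suc k)
  then obtain y where y: "orbit F s k (complex_of_real x) = complex_of_real y"
    by (auto elim: Reals_cases)
  then show ?case using F_real[OF s, of y k] orbit_in[OF Suc.prems, of k] by simp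
qed auto

lemma nonlin_term_real:
  assumes "complex_of_real x \<in> S"
  shows "nonlin_term F s k (complex_of_real x) \<in> \<real>"
proof -
  have "(deriv ^^ m) (F (s j)) (orbit F s j (complex_of_real x)) \<in> \<real>" for m j
  proof -
    obtain y where y: "orbit F s j (complex_of_real x) = complex_of_real y"
      using orbit_real[OF assms] by (auto elim: Reals_cases)
    then show ?thesis
      using orbit_in[OF assms, of j] higher_deriv_in_Reals[OF F_hol[OF s] open_S F_real[OF s]] by simp
  qed
  from this[of 1] this[of 2] show ?thesis
    unfolding nonlin_term_def orbit_deriv_def
    by (intro Reals_mult Reals_divide prod_in_Reals) (simp_all add: numeral_2_eq_2)
qed

lemma nonlin_real:
  assumes "complex_of_real x \<in> S"
  shows "nonlin F s (complex_of_real x) \<in> \<real>"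
proof -
  have "Im (nonlin F s (complex_of_real x)) = (\<Sum>k. Im (nonlin_term F s k (complex_of_real x)))"
    unfolding nonlin_def by (rule bounded_linear.suminf[OF bounded_linear_Im summable_nonlin_term[OF assms]])
  then show ?thesis
    using nonlin_term_real[OF assms] by (simp add: complex_is_Real_iff)
qed

end

text \<open>Sequences with the same first \<open>k\<close> letters share the first \<open>k\<close>
  summands, so only two geometric tails remain. This expresses continuity in the sequence, uniformly
  over \<open>S\<close>.\<close>

lemma nonlin_close:
  assumes "\<And>j. s j \<le> N" "\<And>j. t j \<le> N" "\<And>j. j < k \<Longrightarrow> s j = t j" "z \<in> S"
  shows "norm (nonlin F s z - nonlin F t z) \<le> 2 * M * \<rho> ^ k / (1 - \<rho>)"
proof -
  have "(\<Sum>j<k. nonlin_term F s j z) = (\<Sum>j<k. nonlin_term F t j z)"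
    using assms(3) by (intro sum.cong nonlin_term_cong) auto
  then have "nonlin F s z - nonlin F t z = (nonlin F s z - (\<Sum>j<k. nonlin_term F s j z))
      - (nonlin F t z - (\<Sum>j<k. nonlin_term F t j z))" by simp
  then have "norm (nonlin F s z - nonlin F t z) \<le> M * \<rho> ^ k / (1 - \<rho>) + M * \<rho> ^ k / (1 - \<rho>)"
    using nonlin_tail[where s = s and k = k, OF assms(1,4)] nonlin_tail[where s = t and k = k, OF assms(2,4)]
    by (simp only:) (rule order_trans[OF norm_triangle_ineq4 add_mono])
  then show ?thesis by simp
qed

end

section \<open>Compactness of the space of pairs\<close>

text \<open>Natural numbers less than 1 apart are equal. Letters that converge as real numbers along
  a subsequence are thus eventually fixed.\<close>

lemma convergent_nat_eventually_constant:
  fixes a :: "nat \<Rightarrow> nat"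
  assumes "(\<lambda>n. real (a n)) \<longlonglongrightarrow> L"
  shows "\<exists>m. \<forall>\<^sub>F n in sequentially. a n = m"
proof -
  have "Cauchy (\<lambda>n. real (a n))"
    using assms by (intro convergent_Cauchy convergentI)
  then obtain n\<^sub>0 where "\<forall>m\<ge>n\<^sub>0. \<forall>n\<ge>n\<^sub>0. dist (real (a m)) (real (a n)) < 1"
    by (auto simp: Cauchy_def dest: spec[of _ 1])
  then have "a n = a n\<^sub>0" if "n \<ge> n\<^sub>0" for n
    using that by (fastforce simp: dist_real_def)
  then show ?thesis
    by (auto simp: eventually_sequentially)
qed

text \<open>Otherwise there are pairs and base points near which more and more derivatives become
  smaller and smaller. A subsequence converges to a separated pair whose difference has all
  derivatives zero at one point; by the identity theorem it vanishes on the interval, against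
  \<open>sep\<close>.\<close>

lemma (in holomorphic_ifs) higher_deriv_nonlin_diff_lower_bound:
  assumes d: "d > 0" "\<And>x. x \<in> {0..1} \<Longrightarrow> cball (complex_of_real x) d \<subseteq> S"
    and sep: "\<And>s t. separated_pair N s t \<Longrightarrow>
      \<exists>x\<in>{0..1}. nonlin F s (complex_of_real x) \<noteq> nonlin F t (complex_of_real x)"
  shows "\<exists>K r a. 0 < r \<and> 0 < a \<and> (\<forall>s t. separated_pair N s t \<longrightarrow> (\<forall>x\<in>{0..1}. \<exists>k\<le>K. \<forall>y\<in>{0..1}.
    \<bar>y - x\<bar> \<le> r \<longrightarrow> a \<le> \<bar>Re ((deriv ^^ k) (\<lambda>z. nonlin F s z - nonlin F t z) (complex_of_real y))\<bar>))"
proof (rule ccontr)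
  define h where "h = (\<lambda>s t z. nonlin F s z - nonlin F t z)"
  have in_S: "complex_of_real x \<in> S" if "x \<in> {0..1}" for x
    using d(2)[OF that] d(1) by (meson centre_in_cball less_imp_le subsetD)
  assume contr: "\<not> ?thesis"
  \<comment> \<open>The negated claim, where the failure of each order \<open>k\<close> comes with
    its own witness \<open>y\<close>.\<close>
  have contr': "\<exists>s t. separated_pair N s t \<and> (\<exists>x\<in>{0..1}. \<forall>k\<le>K. \<exists>y\<in>{0..1}.
      \<bar>y - x\<bar> \<le> r \<and> \<bar>Re ((deriv ^^ k) (h s t) (complex_of_real y))\<bar> < a)"
    if "0 < r" "0 < a" for K r a
  proof (rule ccontr)
    assume no: "\<not> ?thesis"
    have "\<exists>k\<le>K. \<forall>y\<in>{0..1}. \<bar>y - x\<bar> \<le> r \<longrightarrow>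
        a \<le> \<bar>Re ((deriv ^^ k) (\<lambda>z. nonlin F s z - nonlin F t z) (complex_of_real y))\<bar>"
      if "separated_pair N s t" "x \<in> {0..1}" for s t x
    proof (rule ccontr)
      assume *: "\<not> ?thesis"
      have "\<exists>y\<in>{0..1}. \<bar>y - x\<bar> \<le> r \<and> \<bar>Re ((deriv ^^ k) (h s t) (complex_of_real y))\<bar> < a" if "k \<le> K" for k
        using * that unfolding h_def not_le[symmetric] by blast
      with no that show False by blast
    qed
    note * = this
    show False
    proof (rule notE[OF contr], rule exI[where x = K], rule exI[where x = r], rule exI[where x = a],
        intro conjI allI impI ballI)
      fix s t x assume "separated_pair N s t" "x \<in> {0..1::real}"
      then show "\<exists>k\<le>K. \<forall>y\<in>{0..1}. \<bar>y - x\<bar> \<le> r \<longrightarrow>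
        a \<le> \<bar>Re ((deriv ^^ k) (\<lambda>z. nonlin F s z - nonlin F t z) (complex_of_real y))\<bar>"
        by (rule *)
    qed fact+
  qed
  \<comment> \<open>Failure with \<open>K = n\<close> and \<open>r = a = 1 / (n + 1)\<close>: in the
    limit every order is covered and both tolerances vanish.\<close>
  define bad where "bad = (\<lambda>n s t x. \<forall>k\<le>n. \<exists>y\<in>{0..1}. \<bar>y - x\<bar> \<le> inverse (real (Suc n)) \<and>
      \<bar>Re ((deriv ^^ k) (h s t) (complex_of_real y))\<bar> < inverse (real (Suc n)))"
  have "\<exists>p. separated_pair N (fst p) (fst (snd p)) \<and> snd (snd p) \<in> {0..1} \<and>
      bad n (fst p) (fst (snd p)) (snd (snd p))" for n
  proof -
    have "\<exists>s t. separated_pair N s t \<and> (\<exists>x\<in>{0..1}. bad n s t x)"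
      unfolding bad_def by (rule contr') simp_all
    then obtain s t x where "separated_pair N s t" "x \<in> {0..1}" "bad n s t x" by blast
    then show ?thesis by (intro exI[of _ "(s, t, x)"]) simp
  qed
  then obtain p where p: "\<And>n. separated_pair N (fst (p n)) (fst (snd (p n)))"
    "\<And>n. snd (snd (p n)) \<in> {0..1}" "\<And>n. bad n (fst (p n)) (fst (snd (p n))) (snd (snd (p n)))"
    by metis
  define s where "s = (\<lambda>n. fst (p n))"
  define t where "t = (\<lambda>n. fst (snd (p n)))"
  define x where "x = (\<lambda>n. snd (snd (p n)))"
  have sx: "\<And>n. separated_pair N (s n) (t n)" "\<And>n. x n \<in> {0..1}" "\<And>n. bad n (s n) (t n) (x n)"
    using p unfolding s_def t_def x_def by simp_all
  \<comment> \<open>The witness depends on the order \<open>k\<close>; the choice is meaningful only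
    for \<open>k \<le> n\<close>.\<close>
  define y where "y = (\<lambda>n k. SOME y. y \<in> {0..1} \<and> \<bar>y - x n\<bar> \<le> inverse (real (Suc n)) \<and>
      \<bar>Re ((deriv ^^ k) (h (s n) (t n)) (complex_of_real y))\<bar> < inverse (real (Suc n)))"
  have y: "y n k \<in> {0..1} \<and> \<bar>y n k - x n\<bar> \<le> inverse (real (Suc n)) \<and>
      \<bar>Re ((deriv ^^ k) (h (s n) (t n)) (complex_of_real (y n k)))\<bar> < inverse (real (Suc n))" if "k \<le> n" for n k
    unfolding y_def by (rule someI_ex) (use sx(3)[of n] that in \<open>simp add: bad_def Bex_def\<close>)
  have st_le: "s n k \<le> N" "t n k \<le> N" for n k
    using sx(1)[of n] by (auto simp: separated_pair_def)
  \<comment> \<open>The base point and both letters at position \<open>k\<close> form one bounded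
    triple, so a single subsequence makes the base points and all letters converge together.\<close>
  define f where "f = (\<lambda>n k. (x n, real (s n k), real (t n k)))"
  have "norm (f n k) \<le> 1 + (real N + real N)" for n k
  proof -
    have "norm (f n k) \<le> norm (x n) + norm (real (s n k), real (t n k))"
      unfolding f_def by (rule norm_Pair_le)
    also have "norm (real (s n k), real (t n k)) \<le> norm (real (s n k)) + norm (real (t n k))"
      by (rule norm_Pair_le)
    finally show ?thesis
      using sx(2)[of n] st_le[of n k] by auto
  qed
  then obtain \<sigma> where \<sigma>: "strict_mono (\<sigma> :: nat \<Rightarrow> nat)" "\<And>k. \<exists>l. (\<lambda>n. f (\<sigma> n) k) \<longlonglongrightarrow> l"
    using function_convergent_subsequence[of UNIV f] by (metis UNIV_I uncountable_def countableI_type)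
  have lims: "\<exists>l. (\<lambda>n. x (\<sigma> n)) \<longlonglongrightarrow> l" "\<exists>l. (\<lambda>n. real (s (\<sigma> n) k)) \<longlonglongrightarrow> l"
    "\<exists>l. (\<lambda>n. real (t (\<sigma> n) k)) \<longlonglongrightarrow> l" for k
  proof -
    obtain l where "(\<lambda>n. (x (\<sigma> n), real (s (\<sigma> n) k), real (t (\<sigma> n) k))) \<longlonglongrightarrow> l"
      using \<sigma>(2)[of k] unfolding f_def by blast
    from tendsto_fst[OF this] tendsto_fst[OF tendsto_snd[OF this]] tendsto_snd[OF tendsto_snd[OF this]]
    show "\<exists>l. (\<lambda>n. x (\<sigma> n)) \<longlonglongrightarrow> l" "\<exists>l. (\<lambda>n. real (s (\<sigma> n) k)) \<longlonglongrightarrow> l"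
      "\<exists>l. (\<lambda>n. real (t (\<sigma> n) k)) \<longlonglongrightarrow> l"
      by auto
  qed
  obtain x\<^sub>0 where x\<^sub>0: "(\<lambda>n. x (\<sigma> n)) \<longlonglongrightarrow> x\<^sub>0" using lims by blast
  have x\<^sub>0_in: "x\<^sub>0 \<in> {0..1}"
    using x\<^sub>0 sx(2) by (intro Lim_in_closed_set[of "{0..1}" "\<lambda>n. x (\<sigma> n)" sequentially]) auto
  define s\<^sub>0 where "s\<^sub>0 = (\<lambda>k. SOME m. \<forall>\<^sub>F n in sequentially. s (\<sigma> n) k = m)"
  have s\<^sub>0: "\<forall>\<^sub>F n in sequentially. s (\<sigma> n) k = s\<^sub>0 k" for k
  proof -
    obtain l where "(\<lambda>n. real (s (\<sigma> n) k)) \<longlonglongrightarrow> l" using lims(2)[of k] by blast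
    from someI_ex[OF convergent_nat_eventually_constant[OF this]] show ?thesis unfolding s\<^sub>0_def .
  qed
  define t\<^sub>0 where "t\<^sub>0 = (\<lambda>k. SOME m. \<forall>\<^sub>F n in sequentially. t (\<sigma> n) k = m)"
  have t\<^sub>0: "\<forall>\<^sub>F n in sequentially. t (\<sigma> n) k = t\<^sub>0 k" for k
  proof -
    obtain l where "(\<lambda>n. real (t (\<sigma> n) k)) \<longlonglongrightarrow> l" using lims(3)[of k] by blast
    from someI_ex[OF convergent_nat_eventually_constant[OF this]] show ?thesis unfolding t\<^sub>0_def .
  qed
  \<comment> \<open>Each clause of \<open>separated_pair\<close> inspects finitely many letters, so
    it passes to the limit: some member of the subsequence agrees with the limit at all of these
    positions.\<close>
  have sep0: "separated_pair N s\<^sub>0 t\<^sub>0"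
  proof -
    have "\<exists>n. s (\<sigma> n) 0 = s\<^sub>0 0 \<and> t (\<sigma> n) 0 = t\<^sub>0 0 \<and> s (\<sigma> n) k = s\<^sub>0 k \<and> t (\<sigma> n) k = t\<^sub>0 k \<and>
        s (\<sigma> n) (Suc k) = s\<^sub>0 (Suc k)" for k
      by (rule eventually_happens'[OF sequentially_bot]) (intro eventually_conj s\<^sub>0 t\<^sub>0)
    then have "s\<^sub>0 0 \<noteq> t\<^sub>0 0 \<and> s\<^sub>0 k \<le> N \<and> t\<^sub>0 k \<le> N \<and> (s\<^sub>0 k = 0 \<longleftrightarrow> t\<^sub>0 k = 0) \<and> (s\<^sub>0 k = 0 \<longrightarrow> s\<^sub>0 (Suc k) = 0)" for k
      using sx(1)[unfolded separated_pair_def] by metis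
    then show ?thesis
      unfolding separated_pair_def by blast
  qed
  have st0_le: "s\<^sub>0 k \<le> N" "t\<^sub>0 k \<le> N" for k
    using sep0 by (auto simp: separated_pair_def)
  have h_hol: "h (s n) (t n) holomorphic_on S" "h s\<^sub>0 t\<^sub>0 holomorphic_on S" for n
    unfolding h_def by (intro holomorphic_on_diff nonlin_hol st_le st0_le)+
  \<comment> \<open>Cauchy's estimate on the disc of radius \<open>d\<close> turns closeness of the
    functions into closeness of their \<open>m\<close>-th derivatives. The constant 4 adds the 2 of
    \<open>nonlin_close\<close> for \<open>s\<close> to that for \<open>t\<close>.\<close>
  have Cauchy: "norm ((deriv ^^ m) (h (s (\<sigma> n)) (t (\<sigma> n))) (complex_of_real u) - (deriv ^^ m) (h s\<^sub>0 t\<^sub>0) (complex_of_real u))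
      \<le> fact m * (4 * M * \<rho> ^ k / (1 - \<rho>)) / d ^ m"
    if agree: "\<And>j. j < k \<Longrightarrow> s (\<sigma> n) j = s\<^sub>0 j \<and> t (\<sigma> n) j = t\<^sub>0 j" and u: "u \<in> {0..1}" for n m k u
  proof -
    let ?g = "\<lambda>z. h (s (\<sigma> n)) (t (\<sigma> n)) z - h s\<^sub>0 t\<^sub>0 z"
    have g_hol: "?g holomorphic_on S" by (intro holomorphic_on_diff h_hol)
    have "norm ((deriv ^^ m) ?g (complex_of_real u)) \<le> fact m * (4 * M * \<rho> ^ k / (1 - \<rho>)) / d ^ m"
    proof (rule Cauchy_inequality)
      show "?g holomorphic_on ball (complex_of_real u) d"
        using g_hol d(2)[OF u] ball_subset_cball by (meson holomorphic_on_subset order_trans)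
      show "continuous_on (cball (complex_of_real u) d) ?g"
        using g_hol d(2)[OF u] by (meson holomorphic_on_imp_continuous_on continuous_on_subset)
      fix z assume "norm (complex_of_real u - z) = d"
      then have z: "z \<in> S" using d(2)[OF u] by (auto simp: dist_norm)
      have "?g z = (nonlin F (s (\<sigma> n)) z - nonlin F s\<^sub>0 z) - (nonlin F (t (\<sigma> n)) z - nonlin F t\<^sub>0 z)"
        by (simp add: h_def)
      also have "norm \<dots> \<le> 2 * M * \<rho> ^ k / (1 - \<rho>) + 2 * M * \<rho> ^ k / (1 - \<rho>)"
        using agree by (intro order_trans[OF norm_triangle_ineq4 add_mono] nonlin_close st_le st0_le z) auto
      finally show "norm (?g z) \<le> 4 * M * \<rho> ^ k / (1 - \<rho>)" by simp
    qed (use d in auto)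
    then show ?thesis
      using higher_deriv_diff[OF h_hol(1)[of "\<sigma> n"] h_hol(2) open_S in_S[OF u], of m] by simp
  qed
  \<comment> \<open>At the witnesses, which tend to the limit base point, the real part of the
    \<open>m\<close>-th derivative for the approximating pair tends to 0, and so does its distance
    from that for the limit pair. Continuity then gives the value at the limit point.\<close>
  have der0: "(deriv ^^ m) (h s\<^sub>0 t\<^sub>0) (complex_of_real x\<^sub>0) = 0" for m
  proof -
    define D where "D = (\<lambda>u. Re ((deriv ^^ m) (h s\<^sub>0 t\<^sub>0) (complex_of_real u)))"
    have "isCont D x\<^sub>0"
    proof -
      have "((\<lambda>u. Re ((deriv ^^ m) (h s\<^sub>0 t\<^sub>0) (complex_of_real u))) has_real_derivative
          Re ((deriv ^^ Suc m) (h s\<^sub>0 t\<^sub>0) (complex_of_real x\<^sub>0))) (at x\<^sub>0)"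
        using h_hol(2) open_S in_S[OF x\<^sub>0_in]
        by (intro field_derivative_along_reals has_field_derivative_higher_deriv)
      then show ?thesis unfolding D_def by (rule DERIV_isCont)
    qed
    have inv0: "(\<lambda>n. inverse (real (Suc (\<sigma> n)))) \<longlonglongrightarrow> 0"
      using LIMSEQ_subseq_LIMSEQ[OF LIMSEQ_inverse_real_of_nat \<sigma>(1)] by (simp add: o_def)
    have ev_m: "\<forall>\<^sub>F n in sequentially. m \<le> \<sigma> n"
      using eventually_subseq[OF \<sigma>(1)] eventually_ge_at_top by blast
    have "(\<lambda>n. y (\<sigma> n) m - x (\<sigma> n)) \<longlonglongrightarrow> 0"
      by (rule Lim_null_comparison[OF _ inv0]) (use ev_m in eventually_elim, use y in auto)
    then have y_lim: "(\<lambda>n. y (\<sigma> n) m) \<longlonglongrightarrow> x\<^sub>0"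
      using tendsto_add[OF _ x\<^sub>0] by fastforce
    have "(\<lambda>n. D (y (\<sigma> n) m)) \<longlonglongrightarrow> D x\<^sub>0"
      by (rule isCont_tendsto_compose[OF \<open>isCont D x\<^sub>0\<close> y_lim])
    moreover have "(\<lambda>n. D (y (\<sigma> n) m)) \<longlonglongrightarrow> 0"
    proof (rule tendstoI)
      fix e :: real assume "e > 0"
      have "(\<lambda>k. fact m * (4 * M * \<rho> ^ k / (1 - \<rho>)) / d ^ m) \<longlonglongrightarrow> fact m * (4 * M * 0 / (1 - \<rho>)) / d ^ m"
        using \<rho> d(1) by (intro tendsto_intros LIMSEQ_realpow_zero) auto
      then have "\<forall>\<^sub>F k in sequentially. fact m * (4 * M * \<rho> ^ k / (1 - \<rho>)) / d ^ m < e / 2"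
        using \<open>e > 0\<close> by (intro order_tendstoD(2)) auto
      then obtain k where k: "fact m * (4 * M * \<rho> ^ k / (1 - \<rho>)) / d ^ m < e / 2"
        by (auto simp: eventually_sequentially)
      have "\<forall>\<^sub>F n in sequentially. \<forall>j\<in>{..<k}. s (\<sigma> n) j = s\<^sub>0 j \<and> t (\<sigma> n) j = t\<^sub>0 j"
        by (intro eventually_ball_finite ballI eventually_conj s\<^sub>0 t\<^sub>0) auto
      moreover have "\<forall>\<^sub>F n in sequentially. inverse (real (Suc (\<sigma> n))) < e / 2"
        using inv0 \<open>e > 0\<close> by (intro order_tendstoD(2)) auto
      ultimately show "\<forall>\<^sub>F n in sequentially. dist (D (y (\<sigma> n) m)) 0 < e"
        using ev_m
      proof eventually_elim
        case (elim n)
        let ?u = "complex_of_real (y (\<sigma> n) m)"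
        have "\<bar>Re ((deriv ^^ m) (h (s (\<sigma> n)) (t (\<sigma> n))) ?u - (deriv ^^ m) (h s\<^sub>0 t\<^sub>0) ?u)\<bar> < e / 2"
          using Cauchy[of k n "y (\<sigma> n) m" m] y[of m "\<sigma> n"] elim k
          by (intro order_le_less_trans[OF abs_Re_le_cmod]) auto
        then show ?case
          using y[of m "\<sigma> n"] elim unfolding D_def dist_real_def minus_complex.simps by linarith
      qed
    qed
    ultimately have "D x\<^sub>0 = 0" using LIMSEQ_unique by blast
    \<comment> \<open>Only real parts were controlled; the imaginary part vanishes because the
      derivatives are real on the real line.\<close>
    moreover have "(deriv ^^ m) (h s\<^sub>0 t\<^sub>0) (complex_of_real x\<^sub>0) \<in> \<real>"
    proof (rule higher_deriv_in_Reals[OF h_hol(2) open_S _ in_S[OF x\<^sub>0_in]])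
      show "h s\<^sub>0 t\<^sub>0 (complex_of_real u) \<in> \<real>" if "complex_of_real u \<in> S" for u
        unfolding h_def by (intro Reals_diff nonlin_real st0_le that)
    qed
    ultimately show ?thesis by (simp add: D_def complex_is_Real_iff complex_eq_iff)
  qed
  have "h s\<^sub>0 t\<^sub>0 (complex_of_real u) = 0" if "u \<in> {0..1}" for u
    using holomorphic_fun_eq_0_on_connected[OF h_hol(2) open_S connected_S der0] in_S x\<^sub>0_in that by blast
  then show False using sep[OF sep0] by (auto simp: h_def)
qed

section \<open>Complex extensions of iterated function systems\<close>

lemma of_real_in_nbhd_I:
  assumes "0 < \<delta>"
  shows "complex_of_real x \<in> nbhd_I \<delta> \<longleftrightarrow> - \<delta> < x \<and> x < 1 + \<delta>"
proof -
  have "complex_of_real x \<in> nbhd_I \<delta> \<longleftrightarrow> (\<exists>y\<in>{0..1}. \<bar>x - y\<bar> < \<delta>)"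
    unfolding nbhd_I_def by (simp flip: of_real_diff)
  also have "\<dots> \<longleftrightarrow> - \<delta> < x \<and> x < 1 + \<delta>"
  proof
    assume "- \<delta> < x \<and> x < 1 + \<delta>"
    then show "\<exists>y\<in>{0..1}. \<bar>x - y\<bar> < \<delta>"
      using assms by (intro bexI[of _ "max 0 (min 1 x)"]) auto
  qed auto
  finally show ?thesis .
qed

lemma open_nbhd_I: "open (nbhd_I \<delta>)"
proof -
  have "nbhd_I \<delta> = (\<Union>x\<in>{0..1}. ball (complex_of_real x) \<delta>)"
    unfolding nbhd_I_def by (auto simp: dist_norm norm_minus_commute)
  then show ?thesis by auto
qed

text \<open>The neighbourhood is the sum of a segment and a ball. Convexity supplies the
  connectedness used in the identity theorem.\<close>

lemma convex_nbhd_I: "convex (nbhd_I \<delta>)"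
proof (rule convexI)
  fix z w :: complex and u v :: real
  assume "z \<in> nbhd_I \<delta>" "w \<in> nbhd_I \<delta>" and uv: "0 \<le> u" "0 \<le> v" "u + v = 1"
  then obtain x y where xy: "x \<in> {0..1}" "y \<in> {0..1}" "norm (z - complex_of_real x) < \<delta>" "norm (w - complex_of_real y) < \<delta>"
    unfolding nbhd_I_def by blast
  have "u * x + v * y \<in> {0..1}"
    using convexD[OF convex_real_interval(5)[of 0 1] xy(1,2) uv] by simp
  moreover have "u *\<^sub>R (z - complex_of_real x) + v *\<^sub>R (w - complex_of_real y) \<in> ball 0 \<delta>"
    using xy uv by (intro convexD[OF convex_ball]) auto
  then have "norm (u *\<^sub>R z + v *\<^sub>R w - complex_of_real (u * x + v * y)) < \<delta>"
    by (simp add: scaleR_conv_of_real algebra_simps)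
  ultimately show "u *\<^sub>R z + v *\<^sub>R w \<in> nbhd_I \<delta>"
    unfolding nbhd_I_def by blast
qed

lemma closure_nbhd_I_subset:
  assumes "\<epsilon> > 0"
  shows "closure (nbhd_I \<epsilon>) \<subseteq> nbhd_I (2 * \<epsilon>)"
proof
  fix z assume "z \<in> closure (nbhd_I \<epsilon>)"
  then obtain w where w: "w \<in> nbhd_I \<epsilon>" "dist w z < \<epsilon>"
    using assms closure_approachable by blast
  then obtain x where x: "x \<in> {0..1}" "norm (w - complex_of_real x) < \<epsilon>"
    unfolding nbhd_I_def by blast
  have "norm (z - complex_of_real x) \<le> norm (z - w) + norm (w - complex_of_real x)"
    using norm_triangle_ineq[of "z - w" "w - complex_of_real x"] by simp
  also have "\<dots> < 2 * \<epsilon>" using w x by (simp add: dist_norm norm_minus_commute)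
  finally show "z \<in> nbhd_I (2 * \<epsilon>)" unfolding nbhd_I_def using x by blast
qed

lemma bounded_nbhd_I: "bounded (nbhd_I \<delta>)"
  unfolding bounded_iff
proof (intro exI ballI)
  fix z assume "z \<in> nbhd_I \<delta>"
  then obtain x where x: "x \<in> {0..1}" "norm (z - complex_of_real x) < \<delta>"
    unfolding nbhd_I_def by blast
  then show "norm z \<le> \<delta> + 1"
    using norm_triangle_ineq[of "z - complex_of_real x" "complex_of_real x"] by simp
qed

lemma cball_subset_nbhd_I: "\<epsilon> > 0 \<Longrightarrow> x \<in> {0..1} \<Longrightarrow> cball (complex_of_real x) (\<epsilon> / 2) \<subseteq> nbhd_I \<epsilon>"
  unfolding nbhd_I_def by (auto simp: dist_norm norm_minus_commute intro!: bexI[of _ x])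

text \<open>The closure of \<open>nbhd_I \<epsilon>\<close> is compact and lies inside the domain of
  the extension, so extrema are attained on it and the pointwise strict inequalities become uniform
  constants.\<close>

lemma analytic_maps_extension:
  assumes "\<epsilon> > 0" "f \<in> analytic_maps \<epsilon>"
  obtains F m \<rho> M where "F holomorphic_on nbhd_I \<epsilon>"
    and "\<And>x. complex_of_real x \<in> nbhd_I \<epsilon> \<Longrightarrow> F (complex_of_real x) = complex_of_real (f x)"
    and "f ` {0..1} \<subseteq> {0..1}" and "F ` nbhd_I \<epsilon> \<subseteq> nbhd_I \<epsilon>"
    and "0 < m" and "\<rho> < 1" and "\<And>z. z \<in> nbhd_I \<epsilon> \<Longrightarrow> m \<le> norm (deriv F z) \<and> norm (deriv F z) \<le> \<rho> \<and>
        norm (deriv (deriv F) z / deriv F z) \<le> M"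
proof -
  obtain F where F: "F analytic_on nbhd_I (2 * \<epsilon>)"
    "\<And>x. complex_of_real x \<in> nbhd_I (2 * \<epsilon>) \<Longrightarrow> F (complex_of_real x) = complex_of_real (f x)"
    "f ` {0..1} \<subseteq> {0..1}" "F ` closure (nbhd_I \<epsilon>) \<subseteq> nbhd_I \<epsilon>"
    "\<And>z. z\<in>closure (nbhd_I \<epsilon>) \<Longrightarrow> 0 < norm (deriv F z) \<and> norm (deriv F z) < 1"
    using assms(2) unfolding analytic_maps_def by blast
  let ?C = "closure (nbhd_I \<epsilon>)"
  have C: "compact ?C" using bounded_nbhd_I by (simp add: compact_closure)
  have "complex_of_real 0 \<in> nbhd_I \<epsilon>" using assms(1) by (subst of_real_in_nbhd_I) auto
  then have ne: "?C \<noteq> {}" using closure_subset by blast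
  have sub: "nbhd_I \<epsilon> \<subseteq> ?C" "?C \<subseteq> nbhd_I (2 * \<epsilon>)"
    using closure_subset closure_nbhd_I_subset[OF assms(1)] by auto
  have hol: "F holomorphic_on nbhd_I (2 * \<epsilon>)" using F(1) analytic_imp_holomorphic by blast
  have cont: "continuous_on ?C (deriv F)" "continuous_on ?C (deriv (deriv F))"
    using hol open_nbhd_I sub(2)
    by (meson holomorphic_deriv holomorphic_on_imp_continuous_on continuous_on_subset)+
  have cn: "continuous_on ?C (\<lambda>z. norm (deriv F z))"
    by (intro continuous_on_norm cont)
  obtain z1 where z1: "z1 \<in> ?C" "\<forall>z\<in>?C. norm (deriv F z1) \<le> norm (deriv F z)"
    using continuous_attains_inf[OF C ne cn] by blast
  obtain z2 where z2: "z2 \<in> ?C" "\<forall>z\<in>?C. norm (deriv F z) \<le> norm (deriv F z2)"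
    using continuous_attains_sup[OF C ne cn] by blast
  have "continuous_on ?C (\<lambda>z. norm (deriv (deriv F) z / deriv F z))"
    using F(5) by (intro continuous_on_norm continuous_on_divide cont) auto
  then obtain z3 where z3: "z3 \<in> ?C" "\<forall>z\<in>?C. norm (deriv (deriv F) z / deriv F z) \<le> norm (deriv (deriv F) z3 / deriv F z3)"
    using continuous_attains_sup[OF C ne] by blast
  show ?thesis
  proof (rule that[of F "norm (deriv F z1)" "norm (deriv F z2)" "norm (deriv (deriv F) z3 / deriv F z3)"])
    show "F holomorphic_on nbhd_I \<epsilon>" using hol sub by (meson holomorphic_on_subset order_trans)
    show "0 < norm (deriv F z1)" "norm (deriv F z2) < 1" using F(5) z1(1) z2(1) by blast+
    show "F (complex_of_real x) = complex_of_real (f x)" if "complex_of_real x \<in> nbhd_I \<epsilon>" for x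
      using F(2) sub that by blast
    show "F ` nbhd_I \<epsilon> \<subseteq> nbhd_I \<epsilon>" using F(4) sub by blast
    show "norm (deriv F z1) \<le> norm (deriv F z) \<and> norm (deriv F z) \<le> norm (deriv F z2) \<and>
        norm (deriv (deriv F) z / deriv F z) \<le> norm (deriv (deriv F) z3 / deriv F z3)" if "z \<in> nbhd_I \<epsilon>" for z
      using z1(2) z2(2) z3(2) sub(1) that by blast
  qed (rule F(3))
qed

text \<open>The derivative of \<open>f\<close> is the real part of that of \<open>F\<close>, which
  is itself real on the real line. The second conclusion has the form of the assumption
  \<open>eq\<close>, so the lemma applies again to the derivatives.\<close>

lemma real_restriction_deriv:
  assumes "F holomorphic_on S" "open S"
    and eq: "\<And>y. complex_of_real y \<in> S \<Longrightarrow> F (complex_of_real y) = complex_of_real (f y)"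
    and x: "complex_of_real x \<in> S"
  shows "(f has_real_derivative deriv f x) (at x)" and "deriv F (complex_of_real x) = complex_of_real (deriv f x)"
proof -
  have "((\<lambda>t. Re (F (complex_of_real t))) has_real_derivative Re (deriv F (complex_of_real x))) (at x)"
    using assms by (intro field_derivative_along_reals holomorphic_derivI)
  then have *: "(f has_real_derivative Re (deriv F (complex_of_real x))) (at x)"
    by (rule has_field_derivative_transform_within_open[where S = "{t. complex_of_real t \<in> S}"])
      (use x eq assms(2) in \<open>auto simp: open_real_trace\<close>)
  then have d: "deriv f x = Re (deriv F (complex_of_real x))" by (rule DERIV_imp_deriv)
  show "(f has_real_derivative deriv f x) (at x)" using * d by simp
  have "deriv F (complex_of_real x) \<in> \<real>"
    by (rule deriv_in_Reals[OF assms(1,2) _ x]) (simp add: eq)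
  then show "deriv F (complex_of_real x) = complex_of_real (deriv f x)"
    using d by (simp add: complex_eq_iff complex_is_Real_iff)
qed

section \<open>Finite words as padded sequences\<close>

definition pad :: "nat list \<Rightarrow> nat \<Rightarrow> nat" where
  "pad w k = (if k < length w then w ! k else 0)"

lemma pad_in: "set w \<subseteq> {1..N} \<Longrightarrow> k < length w \<Longrightarrow> pad w k \<in> {1..N}"
  unfolding pad_def using nth_mem by fastforce

lemma pad_le: "set w \<subseteq> {1..N} \<Longrightarrow> pad w k \<le> N"
  using pad_in[of w N k] by (cases "k < length w") (auto simp: pad_def)

lemma word_map_append: "word_map \<Phi> (u @ v) = word_map \<Phi> u \<circ> word_map \<Phi> v"
  by (induction u) (auto simp: o_assoc)

text \<open>\<open>word_map\<close> applies the last letter first and \<open>orbit\<close> the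
  first, whence the reversal.\<close>

lemma word_map_orbit: "word_map \<Phi> (rev (map s [0..<k])) = orbit \<Phi> s k"
  by (induction k) (auto simp: fun_eq_iff)

lemma map_pad: "k \<le> length w \<Longrightarrow> map (pad w) [0..<k] = take k w"
  by (rule nth_equalityI) (auto simp: pad_def)

lemma word_map_pad: "word_map \<Phi> (rev w) = orbit \<Phi> (pad w) (length w)"
  using word_map_orbit[of \<Phi> "pad w" "length w"] map_pad[of "length w" w] by simp

text \<open>
  Since \<open>0 / 0 = 0\<close>, the choice \<open>F 0 = 0\<close> makes the summands of \<open>nonlin\<close> at the padding letter vanish.
\<close>
locale real_analytic_ifs = holomorphic_ifs +
  fixes \<Phi> :: "nat \<Rightarrow> real \<Rightarrow> real" and m :: real
  assumes F0: "F 0 = (\<lambda>_. 0)"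
    and m: "0 < m"
    and F_eq: "\<And>i x. i \<in> {1..N} \<Longrightarrow> complex_of_real x \<in> S \<Longrightarrow> F i (complex_of_real x) = complex_of_real (\<Phi> i x)"
    and deriv_ge: "\<And>i z. i \<in> {1..N} \<Longrightarrow> z \<in> S \<Longrightarrow> m \<le> norm (deriv (F i) z)"
    and \<Phi>_in: "\<And>i x. i \<in> {1..N} \<Longrightarrow> x \<in> {0..1} \<Longrightarrow> \<Phi> i x \<in> {0..1}"
    and I_in: "\<And>x. x \<in> {0..1} \<Longrightarrow> complex_of_real x \<in> S"
begin

section \<open>Real orbits and their derivatives\<close>

lemma \<Phi>_deriv:
  assumes "i \<in> {1..N}" "complex_of_real x \<in> S"
  shows "(\<Phi> i has_real_derivative deriv (\<Phi> i) x) (at x)"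
    and "deriv (F i) (complex_of_real x) = complex_of_real (deriv (\<Phi> i) x)"
    and "(deriv (\<Phi> i) has_real_derivative deriv (deriv (\<Phi> i)) x) (at x)"
    and "deriv (deriv (F i)) (complex_of_real x) = complex_of_real (deriv (deriv (\<Phi> i)) x)"
proof -
  have hol: "F i holomorphic_on S" using F_hol assms(1) by auto
  note 1 = real_restriction_deriv[OF hol open_S F_eq[OF assms(1)]]
  show "(\<Phi> i has_real_derivative deriv (\<Phi> i) x) (at x)"
    "deriv (F i) (complex_of_real x) = complex_of_real (deriv (\<Phi> i) x)"
    using 1 assms(2) by auto
  note 2 = real_restriction_deriv[OF holomorphic_deriv[OF hol open_S] open_S 1(2)]
  show "(deriv (\<Phi> i) has_real_derivative deriv (deriv (\<Phi> i)) x) (at x)"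
    "deriv (deriv (F i)) (complex_of_real x) = complex_of_real (deriv (deriv (\<Phi> i)) x)"
    using 2 assms(2) by auto
qed

lemma orbit_in_S:
  assumes "\<And>j. j < k \<Longrightarrow> s j \<in> {1..N}" "complex_of_real x \<in> S"
  shows "complex_of_real (orbit \<Phi> s k x) \<in> S \<and> orbit F s k (complex_of_real x) = complex_of_real (orbit \<Phi> s k x)"
  using assms
proof (induction k)
  case (Suc k)
  then have IH: "complex_of_real (orbit \<Phi> s k x) \<in> S" "orbit F s k (complex_of_real x) = complex_of_real (orbit \<Phi> s k x)"
    by auto
  have "s k \<in> {1..N}" using Suc by simp
  then show ?case using F_eq[OF _ IH(1), of "s k"] F_in[OF _ IH(1), of "s k"] IH by auto
qed auto

lemma orbit_in_I:
  assumes "\<And>j. j < k \<Longrightarrow> s j \<in> {1..N}" "x \<in> {0..1}"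
  shows "orbit \<Phi> s k x \<in> {0..1}"
  using assms by (induction k) (use \<Phi>_in in force)+

lemma orbit_deriv_eq:
  assumes "\<And>j. j < k \<Longrightarrow> s j \<in> {1..N}" "complex_of_real x \<in> S"
  shows "orbit_deriv F s k (complex_of_real x) = complex_of_real (orbit_deriv \<Phi> s k x)"
  unfolding orbit_deriv_def of_real_prod
proof (rule prod.cong)
  fix j assume "j \<in> {..<k}"
  then show "deriv (F (s j)) (orbit F s j (complex_of_real x)) = complex_of_real (deriv (\<Phi> (s j)) (orbit \<Phi> s j x))"
    using orbit_in_S[of j s x] \<Phi>_deriv(2)[of "s j" "orbit \<Phi> s j x"] assms by auto
qed auto

lemma nonlin_term_eq:
  assumes "\<And>j. j \<le> k \<Longrightarrow> s j \<in> {1..N}" "complex_of_real x \<in> S"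
  shows "nonlin_term F s k (complex_of_real x) = complex_of_real (nonlin_term \<Phi> s k x)"
proof -
  have "complex_of_real (orbit \<Phi> s k x) \<in> S" "orbit F s k (complex_of_real x) = complex_of_real (orbit \<Phi> s k x)"
    using orbit_in_S[of k s x] assms by auto
  then show ?thesis
    unfolding nonlin_term_def using orbit_deriv_eq[of k s x] \<Phi>_deriv(2,4)[of "s k"] assms by simp
qed

lemma has_derivative_orbit:
  assumes "\<And>j. j < k \<Longrightarrow> s j \<in> {1..N}" "complex_of_real x \<in> S"
  shows "(orbit \<Phi> s k has_real_derivative orbit_deriv \<Phi> s k x) (at x)"
  using assms
proof (induction k)
  case 0
  have "orbit \<Phi> s 0 = (\<lambda>x. x)" by auto
  then show ?case by (simp add: orbit_deriv_def)
next
  case (Suc k)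
  have "(\<Phi> (s k) has_real_derivative deriv (\<Phi> (s k)) (orbit \<Phi> s k x)) (at (orbit \<Phi> s k x))"
    using Suc.prems orbit_in_S[of k s x] by (intro \<Phi>_deriv) auto
  from DERIV_chain[OF this Suc.IH] Suc.prems show ?case
    by (simp add: o_def orbit_deriv_def mult.commute)
qed

lemma orbit_deriv_bounds:
  assumes "\<And>j. j < k \<Longrightarrow> s j \<in> {1..N}" "complex_of_real x \<in> S"
  shows "m ^ k \<le> \<bar>orbit_deriv \<Phi> s k x\<bar>" and "\<bar>orbit_deriv \<Phi> s k x\<bar> \<le> 1"
proof -
  have *: "m \<le> \<bar>deriv (\<Phi> (s j)) (orbit \<Phi> s j x)\<bar> \<and> \<bar>deriv (\<Phi> (s j)) (orbit \<Phi> s j x)\<bar> \<le> 1" if "j < k" for j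
  proof -
    let ?y = "orbit \<Phi> s j x"
    have y: "complex_of_real ?y \<in> S" "s j \<in> {1..N}" using orbit_in_S[of j s x] assms that by auto
    then show ?thesis
      using deriv_ge[of "s j" "complex_of_real ?y"] deriv_le[of "s j" "complex_of_real ?y"] \<Phi>_deriv(2)[of "s j" ?y] \<rho> by auto
  qed
  have "(\<Prod>j<k. m) \<le> (\<Prod>j<k. \<bar>deriv (\<Phi> (s j)) (orbit \<Phi> s j x)\<bar>)"
    using * m by (intro prod_mono) auto
  then show "m ^ k \<le> \<bar>orbit_deriv \<Phi> s k x\<bar>" by (simp add: orbit_deriv_def abs_prod)
  have "(\<Prod>j<k. \<bar>deriv (\<Phi> (s j)) (orbit \<Phi> s j x)\<bar>) \<le> 1"
    using * by (intro prod_le_1) auto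
  then show "\<bar>orbit_deriv \<Phi> s k x\<bar> \<le> 1" by (simp add: orbit_deriv_def abs_prod)
qed

lemma deriv_nonzero:
  assumes "i \<in> {1..N}" "complex_of_real x \<in> S"
  shows "deriv (\<Phi> i) x \<noteq> 0"
  using deriv_ge[OF assms] m \<Phi>_deriv(2)[OF assms] by auto

text \<open>The partial sum of \<open>H\<close> is the logarithmic derivative of the chain rule
  product: each new factor contributes its own logarithmic derivative, which is one summand.\<close>

lemma has_derivative_orbit_deriv:
  assumes "\<And>j. j < k \<Longrightarrow> s j \<in> {1..N}" "complex_of_real x \<in> S"
  shows "(orbit_deriv \<Phi> s k has_real_derivative orbit_deriv \<Phi> s k x * (\<Sum>j<k. nonlin_term \<Phi> s j x)) (at x)"
  using assms
proof (induction k)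
  case 0
  have "orbit_deriv \<Phi> s 0 = (\<lambda>x. 1)" by (auto simp: orbit_deriv_def)
  then show ?case by simp
next
  case (Suc k)
  let ?y = "orbit \<Phi> s k x" and ?f = "\<Phi> (s k)"
  have y: "complex_of_real ?y \<in> S" "s k \<in> {1..N}" using Suc.prems orbit_in_S[of k s x] by auto
  have 1: "((\<lambda>x. deriv ?f (orbit \<Phi> s k x)) has_real_derivative deriv (deriv ?f) ?y * orbit_deriv \<Phi> s k x) (at x)"
    using DERIV_chain2[OF \<Phi>_deriv(3)[OF y(2,1)] has_derivative_orbit] Suc.prems by simp
  have "((\<lambda>x. orbit_deriv \<Phi> s k x * deriv ?f (orbit \<Phi> s k x)) has_real_derivative
     orbit_deriv \<Phi> s k x * (\<Sum>j<k. nonlin_term \<Phi> s j x) * deriv ?f ?y +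
     deriv (deriv ?f) ?y * orbit_deriv \<Phi> s k x * orbit_deriv \<Phi> s k x) (at x)"
    using DERIV_mult[OF Suc.IH 1] Suc.prems by simp
  moreover have "orbit_deriv \<Phi> s (Suc k) = (\<lambda>x. orbit_deriv \<Phi> s k x * deriv ?f (orbit \<Phi> s k x))"
    by (auto simp: orbit_deriv_def)
  moreover have "orbit_deriv \<Phi> s k x * deriv ?f ?y * (\<Sum>j<Suc k. nonlin_term \<Phi> s j x) =
    orbit_deriv \<Phi> s k x * (\<Sum>j<k. nonlin_term \<Phi> s j x) * deriv ?f ?y +
     deriv (deriv ?f) ?y * orbit_deriv \<Phi> s k x * orbit_deriv \<Phi> s k x"
    using deriv_nonzero[OF y(2,1)] by (simp add: nonlin_term_def field_simps)
  ultimately show ?case by simp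
qed

section \<open>Comparison of \<open>H\<close> with the complex series\<close>

lemma H_term_eq:
  assumes "\<And>j. j \<le> k \<Longrightarrow> s j \<in> {1..N}" "complex_of_real x \<in> S"
  shows "complex_of_real (H_term \<Phi> (s k) (map s [0..<k]) x) = nonlin_term F s k (complex_of_real x)"
proof -
  have "deriv (orbit \<Phi> s k) x = orbit_deriv \<Phi> s k x"
    using assms by (intro DERIV_imp_deriv has_derivative_orbit) auto
  then have "H_term \<Phi> (s k) (map s [0..<k]) x = nonlin_term \<Phi> s k x"
    unfolding H_term_def word_map_orbit by (simp add: nonlin_term_def)
  then show ?thesis using nonlin_term_eq assms by simp
qed

lemma nonlin_pad:
  "nonlin F (pad w) z = (\<Sum>j<length w. nonlin_term F (pad w) j z)"
  unfolding nonlin_def by (rule suminf_finite) (auto simp: nonlin_term_def pad_def F0)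

lemma nonlin_pad_real:
  assumes "set w \<subseteq> {1..N}" "complex_of_real x \<in> S"
  shows "nonlin F (pad w) (complex_of_real x) = complex_of_real (\<Sum>j<length w. nonlin_term \<Phi> (pad w) j x)"
  unfolding nonlin_pad of_real_sum using assms pad_in[OF assms(1)]
  by (intro sum.cong refl nonlin_term_eq) auto

lemma H_Fin_eq:
  assumes "set w \<subseteq> {1..N}" "complex_of_real x \<in> S"
  shows "complex_of_real (H \<Phi> (Fin_code w) x) = nonlin F (pad w) (complex_of_real x)"
proof -
  have "complex_of_real (H_term \<Phi> (w ! k) (take k w) x) = nonlin_term F (pad w) k (complex_of_real x)"
    if "k < length w" for k
    using H_term_eq[of k "pad w" x] pad_in[OF assms(1)] that assms(2) map_pad[of k w] by (simp add: pad_def)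
  then show ?thesis by (simp add: nonlin_pad)
qed

lemma H_Inf_eq:
  assumes "range s \<subseteq> {1..N}" "complex_of_real x \<in> S"
  shows "complex_of_real (H \<Phi> (Inf_code s) x) = nonlin F s (complex_of_real x)"
proof -
  have s: "s k \<in> {1..N}" for k using assms(1) by (meson rangeI subsetD)
  have *: "complex_of_real (H_term \<Phi> (s k) (map s [0..<k]) x) = nonlin_term F s k (complex_of_real x)" for k
    using H_term_eq s assms(2) by blast
  have "s k \<le> N" for k using s[of k] by simp
  then have "summable (\<lambda>k. nonlin_term F s k (complex_of_real x))"
    using assms(2) by (rule summable_nonlin_term)
  \<comment> \<open>Convergence, inherited from the complex series, lets the embedding of the reals
    pass through \<open>suminf\<close>.\<close>
  then have "summable (\<lambda>k. H_term \<Phi> (s k) (map s [0..<k]) x)"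
    unfolding *[symmetric] by (simp add: summable_of_real_iff)
  then show ?thesis by (simp add: nonlin_def * suminf_of_real)
qed

text \<open>As zeros persist, a sequence either has no zero or is a finite word, its part before the
  first zero, followed by zeros. The last two conclusions tell how the length of the code is read
  off the zeros and how the code determines the sequence.\<close>

lemma padded_sequence_code:
  assumes "\<And>k. s k \<le> N" "\<And>k. s k = 0 \<Longrightarrow> s (Suc k) = 0"
  obtains \<omega> where "\<omega> \<in> codes N" "\<And>x. complex_of_real x \<in> S \<Longrightarrow> nonlin F s (complex_of_real x) = complex_of_real (H \<Phi> \<omega> x)"
    "\<And>k. enat k < code_length \<omega> \<longleftrightarrow> s k \<noteq> 0"
    "\<omega> = Inf_code s \<or> (\<exists>w. \<omega> = Fin_code w \<and> s = pad w)"
proof (cases "\<forall>k. s k \<noteq> 0")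
  case True
  then have r: "range s \<subseteq> {1..N}" using assms(1) by (auto simp: Suc_le_eq)
  show ?thesis
    by (rule that[of "Inf_code s"]) (use True r H_Inf_eq[OF r] in \<open>auto simp: codes_def\<close>)
next
  case False
  define L where "L = (LEAST k. s k = 0)"
  have "s L = 0" using False unfolding L_def by (auto intro: LeastI)
  have ge: "s (L + k) = 0" for k
    by (induction k) (use \<open>s L = 0\<close> assms(2) in auto)
  have lt: "s k \<noteq> 0" if "k < L" for k using that not_less_Least unfolding L_def by blast
  have iff: "s k \<noteq> 0 \<longleftrightarrow> k < L" for k
    using lt ge[of "k - L"] by (cases "k < L") auto
  define w where "w = map s [0..<L]"
  have s: "s = pad w" using iff by (auto simp: pad_def w_def fun_eq_iff)
  have w: "set w \<subseteq> {1..N}" using assms(1) lt by (auto simp: w_def Suc_le_eq)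
  show ?thesis
  proof (rule that[of "Fin_code w"])
    show "Fin_code w \<in> codes N" using w by (simp add: codes_def)
    show "nonlin F s (complex_of_real x) = complex_of_real (H \<Phi> (Fin_code w) x)"
      if "complex_of_real x \<in> S" for x
      unfolding s using H_Fin_eq[OF w that] by (rule sym)
    show "enat k < code_length (Fin_code w) \<longleftrightarrow> s k \<noteq> 0" for k
      unfolding iff by (simp add: w_def)
  qed (use s in blast)
qed

text \<open>Transfers the hypothesis on codes to padded sequences: a common zero pattern means equal
  length, and different first letters mean different codes. If the series agreed on the whole
  interval, the supremum would be 0.\<close>

lemma nonlin_separated:
  assumes sep: "\<And>v w. v \<in> codes N \<Longrightarrow> w \<in> codes N \<Longrightarrow> v \<noteq> w \<Longrightarrow> code_length v = code_length w \<Longrightarrow>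
           (SUP x\<in>{0..1}. \<bar>H \<Phi> v x - H \<Phi> w x\<bar>) > 0"
    and st: "separated_pair N s t"
  shows "\<exists>x\<in>{0..1}. nonlin F s (complex_of_real x) \<noteq> nonlin F t (complex_of_real x)"
proof (rule ccontr)
  assume no: "\<not> ?thesis"
  have st': "s 0 \<noteq> t 0" "\<And>k. s k \<le> N" "\<And>k. t k \<le> N" "\<And>k. s k = 0 \<longleftrightarrow> t k = 0" "\<And>k. s k = 0 \<Longrightarrow> s (Suc k) = 0"
    using st by (auto simp: separated_pair_def)
  then have t0: "\<And>k. t k = 0 \<Longrightarrow> t (Suc k) = 0" by metis
  obtain v where v: "v \<in> codes N" "\<And>x. complex_of_real x \<in> S \<Longrightarrow> nonlin F s (complex_of_real x) = complex_of_real (H \<Phi> v x)"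
    "\<And>k. enat k < code_length v \<longleftrightarrow> s k \<noteq> 0" "v = Inf_code s \<or> (\<exists>w. v = Fin_code w \<and> s = pad w)"
    using padded_sequence_code[of s] st' by blast
  obtain w where w: "w \<in> codes N" "\<And>x. complex_of_real x \<in> S \<Longrightarrow> nonlin F t (complex_of_real x) = complex_of_real (H \<Phi> w x)"
    "\<And>k. enat k < code_length w \<longleftrightarrow> t k \<noteq> 0" "w = Inf_code t \<or> (\<exists>w'. w = Fin_code w' \<and> t = pad w')"
    using padded_sequence_code[of t] st' t0 by blast
  have lt: "enat k < code_length v \<longleftrightarrow> enat k < code_length w" for k
    unfolding v(3) w(3) st'(4) ..
  have len: "code_length v = code_length w"
  proof (cases "code_length v" "code_length w" rule: enat.exhaust[case_product enat.exhaust])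
    case (enat_enat a b)
    then show ?thesis using lt[of a] lt[of b] by auto
  next
    case (enat_infinity a)
    then show ?thesis using lt[of a] by auto
  next
    case (infinity_enat b)
    then show ?thesis using lt[of b] by auto
  qed auto
  have "v \<noteq> w" using v(4) w(4) st'(1) by auto
  from sep[OF v(1) w(1) this len] have "(SUP x\<in>{0..1}. \<bar>H \<Phi> v x - H \<Phi> w x\<bar>) > 0" .
  moreover have "H \<Phi> v x - H \<Phi> w x = 0" if "x \<in> {0..1}" for x
  proof -
    have "nonlin F s (complex_of_real x) = nonlin F t (complex_of_real x)" using no that by blast
    then show ?thesis using v(2) w(2) I_in[OF that] by simp
  qed
  then have "(SUP x\<in>{0..1}. \<bar>H \<Phi> v x - H \<Phi> w x\<bar>) = (SUP x\<in>{0..1::real}. 0)"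
    by (intro SUP_cong) auto
  ultimately show False by simp
qed

text \<open>The descents go from the \<open>k\<close>-th derivative to \<open>h\<close>, from
  \<open>(A / B) * h\<close> to \<open>A / B - 1\<close>, and from
  \<open>A - B = B * (A / B - 1)\<close> to the difference of the orbits. The last two cost a factor
  \<open>m ^ n\<close> each, and altogether \<open>k + 2\<close> length factors arise, whence the
  exponents.\<close>

lemma orbit_diff_lower_bound:
  fixes v w :: "nat list"
  defines "h \<equiv> \<lambda>z. nonlin F (pad v) z - nonlin F (pad w) z"
  assumes v: "set v \<subseteq> {1..N}" "length v = n" and w: "set w \<subseteq> {1..N}" "length w = n"
    and ab: "0 \<le> \<alpha>" "\<alpha> < \<beta>" "\<beta> \<le> 1" and "0 < a"
    and k: "k \<le> K" "\<And>x. x \<in> {\<alpha>..\<beta>} \<Longrightarrow> a \<le> \<bar>Re ((deriv ^^ k) h (complex_of_real x))\<bar>"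
  shows "\<exists>x\<in>{\<alpha>..\<beta>}. a * m ^ (2 * n) * ((\<beta> - \<alpha>) / 8 ^ (K + 2)) ^ (K + 2)
    \<le> \<bar>orbit \<Phi> (pad v) n x - orbit \<Phi> (pad w) n x\<bar>"
proof -
  let ?\<l> = "\<beta> - \<alpha>"
  define A B where "A = orbit_deriv \<Phi> (pad v) n" and "B = orbit_deriv \<Phi> (pad w) n"
  have in_S: "complex_of_real x \<in> S" if "x \<in> {\<alpha>..\<beta>}" for x using I_in that ab by auto
  have pad_v: "\<And>j. j < n \<Longrightarrow> pad v j \<in> {1..N}" and pad_w: "\<And>j. j < n \<Longrightarrow> pad w j \<in> {1..N}"
    using pad_in v w by auto
  have h_hol: "h holomorphic_on S"
    unfolding h_def by (intro holomorphic_on_diff nonlin_hol pad_le v w)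
  have h_eq: "Re (h (complex_of_real x)) =
      (\<Sum>j<n. nonlin_term \<Phi> (pad v) j x) - (\<Sum>j<n. nonlin_term \<Phi> (pad w) j x)" if "x \<in> {\<alpha>..\<beta>}" for x
    unfolding h_def using nonlin_pad_real[OF v(1) in_S[OF that]] nonlin_pad_real[OF w(1) in_S[OF that]] v(2) w(2)
    by simp
  define D where "D = (\<lambda>j x. Re ((deriv ^^ j) h (complex_of_real x)))"
  have "(D j has_real_derivative D (Suc j) x) (at x)" if "x \<in> {\<alpha>..\<beta>}" for j x
    unfolding D_def using h_hol open_S in_S[OF that]
    by (intro field_derivative_along_reals has_field_derivative_higher_deriv)
  then obtain \<alpha>1 \<beta>1 where 1: "\<alpha> \<le> \<alpha>1" "\<beta>1 \<le> \<beta>" "\<beta>1 - \<alpha>1 = ?\<l> / 4 ^ k"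
      "\<And>x. x\<in>{\<alpha>1..\<beta>1} \<Longrightarrow> a * (?\<l> / 8 ^ Suc k) ^ k \<le> \<bar>Re (h (complex_of_real x))\<bar>"
    using large_on_subinterval_iterated[of \<alpha> \<beta> a D k] ab k \<open>0 < a\<close> unfolding D_def by auto
  define b where "b = a * (?\<l> / 8 ^ Suc k) ^ k"
  have b: "0 < b" unfolding b_def using ab \<open>0 < a\<close> by simp
  have "\<alpha>1 < \<beta>1" using 1(3) ab by (smt (verit) divide_pos_pos zero_less_power)
  have AB: "m ^ n \<le> \<bar>A x\<bar>" "m ^ n \<le> \<bar>B x\<bar>" "\<bar>B x\<bar> \<le> 1" "A x \<noteq> 0" "B x \<noteq> 0" if "x \<in> {\<alpha>..\<beta>}" for x
  proof -
    show "m ^ n \<le> \<bar>A x\<bar>" "m ^ n \<le> \<bar>B x\<bar>" "\<bar>B x\<bar> \<le> 1"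
      unfolding A_def B_def by (intro orbit_deriv_bounds pad_v pad_w in_S that; assumption)+
    then show "A x \<noteq> 0" "B x \<noteq> 0" using zero_less_power[OF m, of n] by auto
  qed
  have R: "((\<lambda>x. A x / B x - 1) has_real_derivative A x / B x * Re (h (complex_of_real x))) (at x)"
    if "x \<in> {\<alpha>1..\<beta>1}" for x
  proof -
    have x: "x \<in> {\<alpha>..\<beta>}" using that 1 by auto
    have A': "(A has_real_derivative A x * (\<Sum>j<n. nonlin_term \<Phi> (pad v) j x)) (at x)"
      unfolding A_def by (intro has_derivative_orbit_deriv pad_v in_S x)
    have B': "(B has_real_derivative B x * (\<Sum>j<n. nonlin_term \<Phi> (pad w) j x)) (at x)"
      unfolding B_def by (intro has_derivative_orbit_deriv pad_w in_S x)
    show ?thesis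
      unfolding h_eq[OF x] using AB(4,5)[OF x]
      by (auto intro!: derivative_eq_intros A' B' simp: field_simps)
  qed
  have "m ^ n * b \<le> \<bar>A x / B x * Re (h (complex_of_real x))\<bar>" if "x \<in> {\<alpha>1..\<beta>1}" for x
  proof -
    have x: "x \<in> {\<alpha>..\<beta>}" using that 1 by auto
    \<comment> \<open>Dividing by \<open>\<bar>B x\<bar> \<le> 1\<close> cannot spoil the lower
      bound on \<open>\<bar>A x\<bar>\<close>.\<close>
    have "m ^ n \<le> \<bar>A x\<bar> / \<bar>B x\<bar>"
      using AB[OF x] by (simp add: pos_le_divide_eq) (smt (verit, best) mult_left_le m zero_le_power)
    then show ?thesis
      unfolding abs_mult abs_divide b_def using 1(4)[OF that] b m by (intro mult_mono) (auto simp: b_def)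
  qed
  then obtain \<alpha>2 \<beta>2 where 2: "\<alpha>1 \<le> \<alpha>2" "\<beta>2 \<le> \<beta>1" "\<beta>2 - \<alpha>2 = (\<beta>1 - \<alpha>1) / 4"
     "\<And>x. x \<in> {\<alpha>2..\<beta>2} \<Longrightarrow> m ^ n * b * ((\<beta>1 - \<alpha>1) / 8) \<le> \<bar>A x / B x - 1\<bar>"
    using large_on_subinterval[OF \<open>\<alpha>1 < \<beta>1\<close> _ R, of "m ^ n * b"] m b by (metis mult_pos_pos zero_less_power)
  have "\<alpha>2 < \<beta>2" using 2(3) \<open>\<alpha>1 < \<beta>1\<close> by (smt (verit) divide_pos_pos)
  define b' where "b' = m ^ (2 * n) * b * ((\<beta>1 - \<alpha>1) / 8)"
  have "0 < b'" unfolding b'_def using m b \<open>\<alpha>1 < \<beta>1\<close> by simp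
  let ?g = "\<lambda>x. orbit \<Phi> (pad v) n x - orbit \<Phi> (pad w) n x"
  have g: "(?g has_real_derivative A x - B x) (at x)" if "x \<in> {\<alpha>2..\<beta>2}" for x
  proof -
    have x: "x \<in> {\<alpha>..\<beta>}" using that 1 2 by auto
    show ?thesis unfolding A_def B_def by (intro DERIV_diff has_derivative_orbit pad_v pad_w in_S x)
  qed
  have "b' \<le> \<bar>A x - B x\<bar>" if "x \<in> {\<alpha>2..\<beta>2}" for x
  proof -
    have x: "x \<in> {\<alpha>..\<beta>}" using that 1 2 by auto
    have "A x - B x = B x * (A x / B x - 1)" using AB(5)[OF x] by (simp add: field_simps)
    then have "\<bar>A x - B x\<bar> = \<bar>B x\<bar> * \<bar>A x / B x - 1\<bar>" by (simp only: abs_mult)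
    moreover have "m ^ n * (m ^ n * b * ((\<beta>1 - \<alpha>1) / 8)) \<le> \<bar>B x\<bar> * \<bar>A x / B x - 1\<bar>"
      using AB(2)[OF x] 2(4)[OF that] m b \<open>\<alpha>1 < \<beta>1\<close> by (intro mult_mono) auto
    moreover have "b' = m ^ n * (m ^ n * b * ((\<beta>1 - \<alpha>1) / 8))"
      unfolding b'_def mult_2 power_add by (simp only: mult_ac)
    ultimately show ?thesis by simp
  qed
  then obtain \<alpha>3 \<beta>3 where 3: "\<alpha>2 \<le> \<alpha>3" "\<beta>3 \<le> \<beta>2" "\<beta>3 - \<alpha>3 = (\<beta>2 - \<alpha>2) / 4"
     "\<And>x. x \<in> {\<alpha>3..\<beta>3} \<Longrightarrow> b' * ((\<beta>2 - \<alpha>2) / 8) \<le> \<bar>?g x\<bar>"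
    using large_on_subinterval[OF \<open>\<alpha>2 < \<beta>2\<close> \<open>0 < b'\<close> g] by metis
  have "\<alpha>3 \<in> {\<alpha>3..\<beta>3}" "\<alpha>3 \<in> {\<alpha>..\<beta>}" using 1 2 3 \<open>\<alpha>2 < \<beta>2\<close> by auto
  \<comment> \<open>A lower bound for all \<open>k + 2\<close> length factors that involves
    \<open>K\<close> but not \<open>k\<close>. Being at most 1, it allows the exponent
    \<open>k + 2\<close> to be raised to \<open>K + 2\<close>.\<close>
  define y where "y = ?\<l> / 8 ^ (K + 2)"
  have y: "0 \<le> y" "y \<le> 1"
    unfolding y_def using ab one_le_power[of "8::real" "K + 2"] by (simp_all add: divide_le_eq_1)
  have "(4::real) ^ k \<le> 8 ^ k" "(8::real) ^ k \<le> 8 ^ K" "0 \<le> (8::real) ^ K"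
    using k(1) by (auto intro: power_mono power_increasing)
  then have pw: "(8::real) ^ k \<le> 8 * 8 ^ K" "(4::real) ^ k \<le> 8 * 8 ^ K" "(4::real) ^ k \<le> 2 * 8 ^ K"
    by linarith+
  have y1: "y \<le> ?\<l> / 8 ^ Suc k" "y \<le> (\<beta>1 - \<alpha>1) / 8" "y \<le> (\<beta>2 - \<alpha>2) / 8"
    unfolding y_def 2(3) 1(3) divide_divide_eq_left using ab pw by (auto intro!: divide_left_mono)
  have "y ^ (K + 2) \<le> y ^ (k + 2)" using y k(1) by (intro power_decreasing) auto
  also have "\<dots> = y ^ k * y * y" by (simp add: power2_eq_square power_add)
  also have "\<dots> \<le> (?\<l> / 8 ^ Suc k) ^ k * ((\<beta>1 - \<alpha>1) / 8) * ((\<beta>2 - \<alpha>2) / 8)"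
    using y y1 ab \<open>\<alpha>1 < \<beta>1\<close> by (intro mult_mono power_mono) auto
  finally have "a * m ^ (2 * n) * y ^ (K + 2) \<le>
      a * m ^ (2 * n) * ((?\<l> / 8 ^ Suc k) ^ k * ((\<beta>1 - \<alpha>1) / 8) * ((\<beta>2 - \<alpha>2) / 8))"
    using \<open>0 < a\<close> m by (intro mult_left_mono) auto
  also have "\<dots> = b' * ((\<beta>2 - \<alpha>2) / 8)" by (simp add: b'_def b_def)
  finally have "a * m ^ (2 * n) * y ^ (K + 2) \<le> \<bar>?g \<alpha>3\<bar>"
    using 3(4)[OF \<open>\<alpha>3 \<in> {\<alpha>3..\<beta>3}\<close>] by linarith
  then show ?thesis unfolding y_def using \<open>\<alpha>3 \<in> {\<alpha>..\<beta>}\<close> by blast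
qed

end


section \<open>Common constants for finitely many maps\<close>

lemma IFSs_real_analytic_ifs:
  assumes "\<epsilon> > 0" "\<Phi> \<in> IFSs \<epsilon> N"
  obtains F \<rho> M m where "real_analytic_ifs (nbhd_I \<epsilon>) N F \<rho> M \<Phi> m" "m \<le> 1"
proof -
  define P where "P = (\<lambda>i F m \<rho> M. F holomorphic_on nbhd_I \<epsilon> \<and>
    (\<forall>x. complex_of_real x \<in> nbhd_I \<epsilon> \<longrightarrow> F (complex_of_real x) = complex_of_real (\<Phi> i x)) \<and>
    \<Phi> i ` {0..1} \<subseteq> {0..1} \<and> F ` nbhd_I \<epsilon> \<subseteq> nbhd_I \<epsilon> \<and> 0 < m \<and> \<rho> < (1::real) \<and>
    (\<forall>z\<in>nbhd_I \<epsilon>. m \<le> norm (deriv F z) \<and> norm (deriv F z) \<le> \<rho> \<and> norm (deriv (deriv F) z / deriv F z) \<le> M))"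
  have "\<exists>q. P i (fst q) (fst (snd q)) (fst (snd (snd q))) (snd (snd (snd q)))" if "i \<in> {1..N}" for i
  proof -
    have "\<Phi> i \<in> analytic_maps \<epsilon>" using assms(2) that by (simp add: IFSs_def)
    then obtain F m \<rho> M where "P i F m \<rho> M"
      unfolding P_def by (rule analytic_maps_extension[OF assms(1)]) blast
    then show ?thesis by (intro exI[of _ "(F, m, \<rho>, M)"]) simp
  qed
  then obtain q where q: "\<And>i. i \<in> {1..N} \<Longrightarrow> P i (fst (q i)) (fst (snd (q i))) (fst (snd (snd (q i)))) (snd (snd (snd (q i))))"
    using bchoice[of "{1..N}" "\<lambda>i q. P i (fst q) (fst (snd q)) (fst (snd (snd q))) (snd (snd (snd q)))"] by blast
  \<comment> \<open>The inserted values 1 and 0 cover \<open>N = 0\<close> and give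
    \<open>m \<le> 1\<close>, \<open>0 \<le> \<rho>\<close> and \<open>0 \<le> M\<close>.\<close>
  define m where "m = Min (insert 1 ((\<lambda>i. fst (snd (q i))) ` {1..N}))"
  define \<rho> where "\<rho> = Max (insert 0 ((\<lambda>i. fst (snd (snd (q i)))) ` {1..N}))"
  define M where "M = Max (insert 0 ((\<lambda>i. snd (snd (snd (q i)))) ` {1..N}))"
  \<comment> \<open>The padding letter gets the zero map, which keeps
    \<open>nbhd_I \<epsilon>\<close> invariant since 0 lies in it, and whose quotient is constantly
    \<open>0 / 0 = 0\<close>.\<close>
  define F where "F = (\<lambda>i. if i \<in> {1..N} then fst (q i) else (\<lambda>_. 0))"
  have q': "0 < fst (snd (q i))" "fst (snd (snd (q i))) < 1" if "i \<in> {1..N}" for i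
    using q[OF that] unfolding P_def by blast+
  have "0 < m" "\<rho> < 1"
    unfolding m_def \<rho>_def using q' by (subst Min_gr_iff Max_less_iff; fastforce)+
  have m: "m \<le> 1" "\<And>i. i \<in> {1..N} \<Longrightarrow> m \<le> fst (snd (q i))"
    unfolding m_def by (rule Min_le; blast)+
  have \<rho>: "0 \<le> \<rho>" "\<And>i. i \<in> {1..N} \<Longrightarrow> fst (snd (snd (q i))) \<le> \<rho>"
    unfolding \<rho>_def by (rule Max_ge; blast)+
  have M: "0 \<le> M" "\<And>i. i \<in> {1..N} \<Longrightarrow> snd (snd (snd (q i))) \<le> M"
    unfolding M_def by (rule Max_ge; blast)+
  have P: "P i (F i) m \<rho> M" if "i \<in> {1..N}" for i
  proof -
    have "F i = fst (q i)" using that by (simp add: F_def)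
    show ?thesis
      using q[OF that] \<open>0 < m\<close> m(2)[OF that] \<open>\<rho> < 1\<close> \<rho>(2)[OF that] M(2)[OF that]
      unfolding P_def \<open>F i = fst (q i)\<close> by (meson order_trans)
  qed
  have F0: "F 0 = (\<lambda>_. 0)" by (simp add: F_def)
  have deriv0: "deriv (\<lambda>_. 0) = (\<lambda>_. 0 :: complex)" by auto
  have zero_in: "0 \<in> nbhd_I \<epsilon>" using of_real_in_nbhd_I[OF assms(1), of 0] assms(1) by simp
  have cases: "i = 0 \<or> i \<in> {1..N}" if "i \<le> N" for i using that by auto
  have "real_analytic_ifs (nbhd_I \<epsilon>) N F \<rho> M \<Phi> m"
  proof
    show "open (nbhd_I \<epsilon>)" "connected (nbhd_I \<epsilon>)"
      by (simp_all add: open_nbhd_I convex_nbhd_I convex_connected)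
    fix i assume "i \<le> N"
    then have i: "i = 0 \<or> i \<in> {1..N}" by (rule cases)
    show F_hol: "F i holomorphic_on nbhd_I \<epsilon>"
      using i P[of i] by (auto simp: F0 P_def)
    show "F i z \<in> nbhd_I \<epsilon>" if "z \<in> nbhd_I \<epsilon>" for z
      using i P[of i] that zero_in by (auto simp: F0 P_def)
    show "F i (complex_of_real x) \<in> \<real>" if "complex_of_real x \<in> nbhd_I \<epsilon>" for x
      using i P[of i] that by (auto simp: F0 P_def)
    show "norm (deriv (F i) z) \<le> \<rho>" if "z \<in> nbhd_I \<epsilon>" for z
      using i P[of i] that \<rho>(1) by (auto simp: F0 P_def)
    show "norm (deriv (deriv (F i)) z / deriv (F i) z) \<le> M" if "z \<in> nbhd_I \<epsilon>" for z
      using i P[of i] that M(1) by (auto simp: F0 P_def)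
    show "(\<lambda>z. deriv (deriv (F i)) z / deriv (F i) z) holomorphic_on nbhd_I \<epsilon>"
    proof (cases "i = 0")
      case False
      then have "P i (F i) m \<rho> M" using i P by blast
      then have "deriv (F i) z \<noteq> 0" if "z \<in> nbhd_I \<epsilon>" for z
        using that \<open>0 < m\<close> unfolding P_def by force
      then show ?thesis
        using F_hol open_nbhd_I by (intro holomorphic_on_divide holomorphic_deriv) auto
    qed (simp add: F0 deriv0)
  next
    fix i assume i: "i \<in> {1..N}"
    show "F i (complex_of_real x) = complex_of_real (\<Phi> i x)" if "complex_of_real x \<in> nbhd_I \<epsilon>" for x
      using P[OF i] that unfolding P_def by blast
    show "m \<le> norm (deriv (F i) z)" if "z \<in> nbhd_I \<epsilon>" for z
      using P[OF i] that unfolding P_def by blast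
    show "\<Phi> i x \<in> {0..1}" if "x \<in> {0..1}" for x
      using P[OF i] that unfolding P_def by blast
  next
    show "complex_of_real x \<in> nbhd_I \<epsilon>" if "x \<in> {0..1}" for x
      using that assms(1) by (simp add: of_real_in_nbhd_I)
  qed (use \<open>0 < m\<close> \<open>\<rho> < 1\<close> \<rho>(1) M(1) F0 in auto)
  then show ?thesis using m(1) by (rule that)
qed

text \<open>By the mean value theorem the images of 0 and 1 are at least \<open>m ^ length p\<close>
  apart, and the image, being connected, contains everything between them. Which of the two is
  smaller depends on the orientation of the map.\<close>

lemma (in real_analytic_ifs) orbit_image_contains_interval:
  assumes "set p \<subseteq> {1..N}"
  obtains \<alpha> \<beta> where "0 \<le> \<alpha>" "\<beta> \<le> 1" "m ^ length p \<le> \<beta> - \<alpha>"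
    "{\<alpha>..\<beta>} \<subseteq> orbit \<Phi> (pad p) (length p) ` {0..1}"
proof -
  let ?f = "orbit \<Phi> (pad p) (length p)"
  have p: "\<And>j. j < length p \<Longrightarrow> pad p j \<in> {1..N}" using pad_in[OF assms] .
  have d: "(?f has_real_derivative orbit_deriv \<Phi> (pad p) (length p) x) (at x)" if "0 \<le> x" "x \<le> 1" for x
    using that by (intro has_derivative_orbit p I_in) auto
  obtain z where z: "0 < z" "z < 1" "?f 1 - ?f 0 = (1 - 0) * orbit_deriv \<Phi> (pad p) (length p) z"
    using MVT2[of 0 1 ?f, OF _ d] by auto
  have "m ^ length p \<le> \<bar>orbit_deriv \<Phi> (pad p) (length p) z\<bar>"
    using z by (intro orbit_deriv_bounds p I_in) auto
  then have len: "m ^ length p \<le> \<bar>?f 1 - ?f 0\<bar>" using z by simp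
  have in_I: "?f 0 \<in> {0..1}" "?f 1 \<in> {0..1}"
    by (auto intro!: orbit_in_I[of "length p" "pad p", simplified] dest: p)
  have "continuous_on {0..1} ?f"
    by (intro continuous_at_imp_continuous_on ballI) (use d in \<open>auto intro: DERIV_isCont\<close>)
  then have "connected (?f ` {0..1})" by (intro connected_continuous_image) auto
  then have sub: "{?f 0..?f 1} \<subseteq> ?f ` {0..1}" "{?f 1..?f 0} \<subseteq> ?f ` {0..1}"
    by (intro connected_contains_Icc imageI; simp)+
  show ?thesis
  proof (cases "?f 0 \<le> ?f 1")
    case True
    then show ?thesis using that[of "?f 0" "?f 1"] len in_I sub(1) by simp
  next
    case False
    then show ?thesis using that[of "?f 1" "?f 0"] len in_I sub(2) by simp
  qed
qed

section \<open>Exponential separation of words of equal length\<close>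

theorem theorem1p5:
  fixes \<epsilon> :: real and N :: nat and \<Phi> :: "nat \<Rightarrow> real \<Rightarrow> real"
  assumes "\<epsilon> > 0"
    and "\<Phi> \<in> IFSs \<epsilon> N"
    and "\<And>v w. v \<in> codes N \<Longrightarrow> w \<in> codes N \<Longrightarrow> v \<noteq> w \<Longrightarrow> code_length v = code_length w \<Longrightarrow>
           (SUP x\<in>{0..1}. \<bar>H \<Phi> v x - H \<Phi> w x\<bar>) > 0"
  shows "SESC N \<Phi>"
proof -
  obtain F \<rho> M m where ifs: "real_analytic_ifs (nbhd_I \<epsilon>) N F \<rho> M \<Phi> m" and "m \<le> 1"
    using IFSs_real_analytic_ifs[OF assms(1,2)] by blast
  interpret real_analytic_ifs "nbhd_I \<epsilon>" N F \<rho> M \<Phi> m by (rule ifs)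
  have "0 < \<epsilon> / 2" using assms(1) by simp
  from higher_deriv_nonlin_diff_lower_bound[OF this cball_subset_nbhd_I[OF assms(1)] nonlin_separated[OF assms(3)]]
  obtain K r a where "0 < r" "0 < a" and large: "\<And>s t x. separated_pair N s t \<Longrightarrow> x \<in> {0..1} \<Longrightarrow> \<exists>k\<le>K. \<forall>y\<in>{0..1}.
    \<bar>y - x\<bar> \<le> r \<longrightarrow> a \<le> \<bar>Re ((deriv ^^ k) (\<lambda>z. nonlin F s z - nonlin F t z) (complex_of_real y))\<bar>"
    by blast
  define r\<^sub>0 where "r\<^sub>0 = min r 1"
  \<comment> \<open>The part of the lower bound independent of \<open>n\<close>, capped at 1 so that
    \<open>C ^ n \<le> C\<close> for \<open>n \<ge> 1\<close>.\<close>
  define C where "C = min 1 (a * (r\<^sub>0 / 8 ^ (K + 2)) ^ (K + 2))"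
  have r\<^sub>0: "0 < r\<^sub>0" "r\<^sub>0 \<le> r" "r\<^sub>0 \<le> 1" using \<open>0 < r\<close> by (auto simp: r\<^sub>0_def)
  have C: "0 < C" "C \<le> 1" "C \<le> a * (r\<^sub>0 / 8 ^ (K + 2)) ^ (K + 2)"
    using r\<^sub>0 \<open>0 < a\<close> by (auto simp: C_def)
  show ?thesis
    unfolding SESC_def
  \<comment> \<open>The exponent of \<open>m\<close> is \<open>2 * n\<close> from the derivatives of
    the two orbits plus \<open>n * (K + 2)\<close> from the power of the interval length
    \<open>\<l>\<close>.\<close>
  proof (rule exI[of _ "C * m ^ (K + 4)"], intro conjI allI ballI impI)
    show "0 < C * m ^ (K + 4)" using C m by simp
    fix n v w
    assume v: "v \<in> words_of_length N n" and w: "w \<in> words_of_length N n" and "v \<noteq> w"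
    \<comment> \<open>Since \<open>word_map\<close> applies the last letter first, a common suffix
      is a common inner map, and it is a common prefix of the reversed words. Splitting off the
      longest one leaves remainders with different first letters.\<close>
    obtain p v' w' where pvw: "rev v = p @ v'" "rev w = p @ w'" "v' = [] \<or> w' = [] \<or> hd v' \<noteq> hd w'"
      using longest_common_prefix[of "rev v" "rev w"] by blast
    have len: "length v' = length w'" "length p + length v' = n"
      using arg_cong[OF pvw(1), of length] arg_cong[OF pvw(2), of length] v w by (auto simp: words_of_length_def)
    have "v' \<noteq> []" "w' \<noteq> []" using \<open>v \<noteq> w\<close> pvw len rev_is_rev_conv[of v w] by auto
    have "set (rev v) \<subseteq> {1..N}" "set (rev w) \<subseteq> {1..N}" using v w by (auto simp: words_of_length_def)
    then have sets: "set p \<subseteq> {1..N}" "set v' \<subseteq> {1..N}" "set w' \<subseteq> {1..N}"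
      unfolding pvw by auto
    have "n \<ge> 1" using len \<open>v' \<noteq> []\<close> by (cases v') auto
    have sep: "separated_pair N (pad v') (pad w')"
    proof -
      have "pad v' 0 \<noteq> pad w' 0"
        using pvw(3) \<open>v' \<noteq> []\<close> \<open>w' \<noteq> []\<close> by (simp add: pad_def hd_conv_nth)
      moreover have "pad v' k = 0 \<longleftrightarrow> length v' \<le> k" "pad w' k = 0 \<longleftrightarrow> length v' \<le> k" for k
        using pad_in[OF sets(2), of k] pad_in[OF sets(3), of k] len(1) by (auto simp: pad_def)
      ultimately show ?thesis
        unfolding separated_pair_def using pad_le sets by auto
    qed
    let ?\<phi> = "orbit \<Phi> (pad p) (length p)"
    obtain \<alpha> \<beta> where ab: "0 \<le> \<alpha>" "\<beta> \<le> 1" "m ^ length p \<le> \<beta> - \<alpha>" "{\<alpha>..\<beta>} \<subseteq> ?\<phi> ` {0..1}"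
      using orbit_image_contains_interval[OF sets(1)] by blast
    \<comment> \<open>Short enough to stay within distance \<open>r\<close> of \<alpha> and inside
      the image interval, whose length is at least \<open>m ^ length p \<ge> m ^ n\<close>.\<close>
    define \<l> where "\<l> = r\<^sub>0 * m ^ n"
    have pow: "0 < m ^ n" "m ^ n \<le> 1" "m ^ n \<le> m ^ length p"
      using m \<open>m \<le> 1\<close> len by (auto intro: power_le_one power_decreasing)
    have "0 < \<l>" unfolding \<l>_def using r\<^sub>0 pow by simp
    moreover have "\<l> \<le> 1 * m ^ n" unfolding \<l>_def using r\<^sub>0 pow by (intro mult_right_mono) auto
    moreover have "\<l> \<le> r\<^sub>0 * 1" unfolding \<l>_def using r\<^sub>0 pow by (intro mult_left_mono) auto
    ultimately have \<l>: "0 < \<l>" "\<l> \<le> r" "\<alpha> + \<l> \<le> \<beta>"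
      using r\<^sub>0 pow ab(3) by linarith+
    have "\<alpha> \<in> {0..1}" using ab \<l> by auto
    \<comment> \<open>The order \<open>k\<close> found at the left endpoint serves the whole
      interval, because its length is at most \<open>r\<close>.\<close>
    from large[OF sep this] obtain k where k: "k \<le> K" "\<And>y. y \<in> {0..1} \<Longrightarrow> \<bar>y - \<alpha>\<bar> \<le> r \<Longrightarrow>
        a \<le> \<bar>Re ((deriv ^^ k) (\<lambda>z. nonlin F (pad v') z - nonlin F (pad w') z) (complex_of_real y))\<bar>"
      by blast
    obtain y where y: "y \<in> {\<alpha>..\<alpha> + \<l>}" "a * m ^ (2 * length v') * ((\<alpha> + \<l> - \<alpha>) / 8 ^ (K + 2)) ^ (K + 2)
        \<le> \<bar>orbit \<Phi> (pad v') (length v') y - orbit \<Phi> (pad w') (length v') y\<bar>"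
      using orbit_diff_lower_bound[OF sets(2) refl sets(3) len(1)[symmetric], of \<alpha> "\<alpha> + \<l>" a k K] k ab \<l> \<open>0 < a\<close>
      by auto
    have "y \<in> {\<alpha>..\<beta>}" using y(1) \<l>(3) by auto
    then obtain x where x: "x \<in> {0..1}" "y = ?\<phi> x" using ab(4) by blast
    \<comment> \<open>As \<open>y\<close> is the image of \<open>x\<close> under the common inner
      map, the full words at \<open>x\<close> take the values of the remainders at
      \<open>y\<close>.\<close>
    have "v = rev v' @ rev p" "w = rev w' @ rev p" using pvw by (metis rev_append rev_rev_ident)+
    then have eq: "word_map \<Phi> v x = orbit \<Phi> (pad v') (length v') y" "word_map \<Phi> w x = orbit \<Phi> (pad w') (length v') y"
      using x(2) len(1) by (simp_all add: word_map_append word_map_pad)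
    have "(C * m ^ (K + 4)) ^ n = C ^ n * m ^ (n * (K + 4))"
      by (simp add: power_mult_distrib mult.commute flip: power_mult)
    also have "\<dots> \<le> C * m ^ (n * (K + 4))"
      using C m \<open>n \<ge> 1\<close> power_decreasing[of 1 n C] by (intro mult_right_mono) auto
    also have "\<dots> \<le> a * (r\<^sub>0 / 8 ^ (K + 2)) ^ (K + 2) * m ^ (n * (K + 4))"
      using C m by (intro mult_right_mono) auto
    also have "\<dots> = a * m ^ (2 * n) * (\<l> / 8 ^ (K + 2)) ^ (K + 2)"
    proof -
      have "m ^ (n * (K + 4)) = m ^ (2 * n) * (m ^ n) ^ (K + 2)"
        by (simp add: algebra_simps flip: power_mult power_add)
      then show ?thesis by (simp only: \<l>_def power_divide power_mult_distrib) (simp add: field_simps)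
    qed
    also have "\<dots> \<le> a * m ^ (2 * length v') * (\<l> / 8 ^ (K + 2)) ^ (K + 2)"
      using \<open>0 < a\<close> m \<open>m \<le> 1\<close> len \<l> by (intro mult_right_mono mult_left_mono power_decreasing) auto
    also have "\<dots> \<le> \<bar>word_map \<Phi> v x - word_map \<Phi> w x\<bar>" using y(2) eq by simp
    also have "\<dots> \<le> (SUP x\<in>{0..1}. \<bar>word_map \<Phi> v x - word_map \<Phi> w x\<bar>)"
    \<comment> \<open>The supremum bounds its members only if the set is bounded above, which holds
      as all word maps preserve the unit interval.\<close>
    proof (rule cSUP_upper[OF x(1)])
      have in_I: "word_map \<Phi> u x \<in> {0..1}" if "u \<in> words_of_length N n" "x \<in> {0..1}" for u x
        using orbit_in_I[of "length (rev u)" "pad (rev u)" x] pad_in[of "rev u" N] that word_map_pad[of \<Phi> "rev u"]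
        by (simp add: words_of_length_def)
      show "bdd_above ((\<lambda>x. \<bar>word_map \<Phi> v x - word_map \<Phi> w x\<bar>) ` {0..1})"
      proof (rule bdd_aboveI2)
        show "\<bar>word_map \<Phi> v x - word_map \<Phi> w x\<bar> \<le> 1" if "x \<in> {0..1}" for x
          using in_I[OF v that] in_I[OF w that] by auto
      qed
    qed
    finally show "(C * m ^ (K + 4)) ^ n \<le> (SUP x\<in>{0..1}. \<bar>word_map \<Phi> v x - word_map \<Phi> w x\<bar>)" .
  qed
qed

end
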